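(* Let $X_1,X_2,\dots$ be independent, identically distributed random variables from a distribution $p$ with mean $0$, variance $1$ and finite higher moments. For $\omega=(x_1,x_2,\dots)$ set $X_\ell(\omega)=x_\ell$, and consider the probability space $(\Omega,\mathcal{F},\mathbb{P})$ of such sequences, where $\mathbb{P}$ is induced from $\mathrm{Prob}(X_\ell(\omega)\le x)=\int_{-\infty}^x p(t)\,dt$. For $n\ge 1$ and $1\le k\le n$ let $$S_n^{(k)}(\omega)=\frac{1}{\sqrt{n/2}}\sum_{\ell=1}^n X_\ell(\omega)\cos(\pi k\ell/n).$$ Then $$\mathbb{P}\left(\left\{\omega\in\Omega:\ \sup_{x\in\mathbb{R}}\left|\frac1n\sum_{k=1}^n I_{S_n^{(k)}(\omega)\le x}-\Phi(x)\right|\to 0\ \text{ as } n\to\infty\right\}\right)=1.$$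
   Context: $I$ denotes the indicator function (so $I_{S\le x}$ equals $1$ if $S\le x$ and $0$ otherwise), and $\Phi(x)=\frac{1}{\sqrt{2\pi}}\int_{-\infty}^x e^{-t^2/2}\,dt$ is the distribution function of the standard normal. $\Omega$ is the space of infinite real sequences with the product measure making the coordinates $X_\ell$ independent with distribution $p$. "Finite higher moments" means all moments of $p$ are finite. *)

theory Defs
  imports "HOL-Probability.Probability"
begin

definition Phi :: "real \<Rightarrow> real" where
  "Phi x = 1 / sqrt (2 * pi) * (LBINT t:{..x}. exp (- (t\<^sup>2) / 2))"

definition law :: "(real \<Rightarrow> real) \<Rightarrow> real measure" where
  "law p = density lborel (\<lambda>t. ennreal (p t))"

text \<open>
  A sequence \<open>(x\<^sub>1, x\<^sub>2, \<dots>)\<close> is an element of the product over the index set \<open>{1..}\<close>, so its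
  terms are numbered from 1.
\<close>

definition seq_space :: "(real \<Rightarrow> real) \<Rightarrow> (nat \<Rightarrow> real) measure" where
  "seq_space p = (\<Pi>\<^sub>M l\<in>{1..}. law p)"

definition X :: "nat \<Rightarrow> (nat \<Rightarrow> real) \<Rightarrow> real" where
  "X l \<omega> = \<omega> l"

definition S :: "nat \<Rightarrow> nat \<Rightarrow> (nat \<Rightarrow> real) \<Rightarrow> real" where
  "S n k \<omega> =
     1 / sqrt (real n / 2) * (\<Sum>l=1..n. X l \<omega> * cos (pi * real k * real l / real n))"

end

theory Submission
  imports Defs
begin

text \<open>
  For a bounded function \<open>f\<close> with Lipschitz derivative put \<open>F n = (1/n) (\<Sum>k\<le>n. f (S n k))\<close>. The
  matrix \<open>cos (pi k l / n) / sqrt (n/2)\<close> is almost orthogonal, so the gradient of \<open>F n\<close> in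
  \<open>(x\<^sub>1, \<dots>, x\<^sub>n)\<close> has squared norm \<open>O(1/n)\<close>. Applying the Efron-Stein inequality both to the centred
  \<open>F n\<close> and to its square bounds its fourth central moment by \<open>O(n powr (- 3/2))\<close>, where the eighth
  moment of \<open>p\<close> controls the largest coordinate. This is summable, so \<open>F n\<close> minus its mean tends to
  0 almost surely. The mean tends to the Gaussian integral of \<open>f\<close> because for \<open>k < n\<close> the
  coefficients of \<open>S n k\<close> have square sum 1 and are uniformly small. Countably many smoothed step
  functions \<open>f\<close> then give convergence at all rational points, which is uniform by Polya's theorem.
\<close>

subsection \<open>Orthogonality of cosines\<close>

lemma sum_cos_roots_of_unity:
  fixes j :: int and N :: nat
  assumes "\<not> int N dvd j"
  shows "(\<Sum>l<N. cos (2 * pi * real_of_int j * real l / real N)) = 0"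
proof (cases "N = 0")
  case False
  define \<theta> where "\<theta> = 2 * pi * real_of_int j / real N"
  have "cis \<theta> \<noteq> 1"
  proof
    assume "cis \<theta> = 1"
    then have "cos \<theta> = 1" by (metis cis.sel(1) one_complex.sel(1))
    then obtain m :: int where "\<theta> = of_int m * 2 * pi"
      using cos_one_2pi_int by auto
    then have "real_of_int j = real_of_int (m * int N)"
      using False by (simp add: \<theta>_def field_simps)
    then have "j = m * int N" by (simp only: of_int_eq_iff)
    then show False using assms by simp
  qed
  moreover have "cis \<theta> ^ N = 1"
  proof -
    have "real N * \<theta> = 2 * pi * of_int j"
      using False by (simp add: \<theta>_def)
    then have "cis \<theta> ^ N = cis (2 * pi * of_int j)"
      by (simp only: Complex.DeMoivre)
    then show ?thesis by (simp add: cis_multiple_2pi)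
  qed
  ultimately have "(\<Sum>l<N. cis \<theta> ^ l) = 0"
    by (simp add: geometric_sum)
  then have "(\<Sum>l<N. Re (cis \<theta> ^ l)) = 0"
    by (metis Re_sum zero_complex.sel(1))
  then show ?thesis
    by (simp add: Complex.DeMoivre \<theta>_def algebra_simps)
qed simp

lemma sum_cos_mult_cos:
  fixes n k k' :: nat
  assumes "1 \<le> k" "k \<le> n" "1 \<le> k'" "k' \<le> n" "k \<noteq> k'"
  shows "(\<Sum>l<2*n. cos (pi * real k * real l / real n) * cos (pi * real k' * real l / real n)) = 0"
proof -
  have *: "\<not> int (2 * n) dvd j" if "j \<noteq> 0" "\<bar>j\<bar> < int (2 * n)" for j
    using that dvd_imp_le_int[of j "int (2 * n)"] by auto
  have 1: "(\<Sum>l<2*n. cos (2 * pi * real_of_int (int k - int k') * real l / real (2*n))) = 0"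
    by (rule sum_cos_roots_of_unity, rule *) (use assms in auto)
  have 2: "(\<Sum>l<2*n. cos (2 * pi * real_of_int (int k + int k') * real l / real (2*n))) = 0"
    by (rule sum_cos_roots_of_unity, rule *) (use assms in auto)
  have "cos (pi * real k * real l / real n) * cos (pi * real k' * real l / real n) =
     cos (2 * pi * real_of_int (int k - int k') * real l / real (2*n)) / 2 +
     cos (2 * pi * real_of_int (int k + int k') * real l / real (2*n)) / 2" for l
  proof -
    have "2 * pi * real_of_int (int k - int k') * real l / real (2*n)
        = pi * real k * real l / real n - pi * real k' * real l / real n"
      and "2 * pi * real_of_int (int k + int k') * real l / real (2*n)
        = pi * real k * real l / real n + pi * real k' * real l / real n"
      using assms by (simp_all add: field_simps)
    then show ?thesis by (simp only: cos_times_cos add_divide_distrib)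
  qed
  then show ?thesis
    using 1 2 by (simp add: sum.distrib sum_divide_distrib[symmetric])
qed

text \<open>The sum over \<open>l\<close> is enlarged to the full period \<open>2 n\<close>, over which the cosines are orthogonal.\<close>

lemma sum_cos_transform_squared_le:
  fixes n :: nat and v :: "nat \<Rightarrow> real"
  shows "(\<Sum>l=1..n. (\<Sum>k=1..n. v k * cos (pi * real k * real l / real n))\<^sup>2)
    \<le> 2 * real n * (\<Sum>k=1..n. (v k)\<^sup>2)"
proof -
  let ?c = "\<lambda>k l. cos (pi * real k * real l / real n)"
  have "(\<Sum>l=1..n. (\<Sum>k=1..n. v k * ?c k l)\<^sup>2) \<le> (\<Sum>l<2*n. (\<Sum>k=1..n. v k * ?c k l)\<^sup>2)"
    by (rule sum_mono2) auto
  also have "\<dots> = (\<Sum>l<2*n. \<Sum>k=1..n. \<Sum>k'=1..n. v k * v k' * (?c k l * ?c k' l))"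
    by (simp add: power2_eq_square sum_product algebra_simps)
  also have "\<dots> = (\<Sum>k=1..n. \<Sum>k'=1..n. \<Sum>l<2*n. v k * v k' * (?c k l * ?c k' l))"
    by (subst sum.swap, rule sum.cong[OF refl], rule sum.swap)
  also have "\<dots> = (\<Sum>k=1..n. \<Sum>k'=1..n. v k * v k' * (\<Sum>l<2*n. ?c k l * ?c k' l))"
    by (simp only: sum_distrib_left)
  also have "\<dots> = (\<Sum>k=1..n. \<Sum>k'=1..n. if k' = k then (v k)\<^sup>2 * (\<Sum>l<2*n. (?c k l)\<^sup>2) else 0)"
    by (intro sum.cong refl) (auto simp: sum_cos_mult_cos power2_eq_square)
  also have "\<dots> = (\<Sum>k=1..n. (v k)\<^sup>2 * (\<Sum>l<2*n. (?c k l)\<^sup>2))"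
    by (intro sum.cong refl) (simp add: sum.delta)
  also have "\<dots> \<le> (\<Sum>k=1..n. (v k)\<^sup>2 * (2 * real n))"
  proof (intro sum_mono mult_left_mono)
    fix k
    have "(\<Sum>l<2*n. (?c k l)\<^sup>2) \<le> (\<Sum>l<2*n. 1)"
      by (intro sum_mono) (simp add: abs_square_le_1)
    then show "(\<Sum>l<2*n. (?c k l)\<^sup>2) \<le> 2 * real n" by simp
  qed auto
  finally show ?thesis by (simp add: sum_distrib_left algebra_simps)
qed

text \<open>For \<open>k = n\<close> the sum is 2, so \<open>S n n\<close> has variance 2.\<close>

lemma sum_cos_squared_coeffs:
  fixes n k :: nat
  assumes "1 \<le> k" "k < n"
  shows "(\<Sum>l=1..n. (cos (pi * real k * real l / real n) / sqrt (real n / 2))\<^sup>2) = 1"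
proof -
  have eq: "cos (pi * real k * real l / real n) ^ 2 =
      1 / 2 + cos (2 * pi * real_of_int (int k) * real l / real n) / 2" for l
    using cos_double_cos[of "pi * real k * real l / real n"] by (simp add: mult.assoc field_simps)
  have "(\<Sum>l<n. cos (2 * pi * real_of_int (int k) * real l / real n)) = 0"
    by (rule sum_cos_roots_of_unity) (use assms zdvd_not_zless in auto)
  moreover have "{..<Suc n} = insert 0 {1..n}" by auto
  then have "(\<Sum>l<Suc n. cos (2 * pi * real_of_int (int k) * real l / real n))
     = 1 + (\<Sum>l=1..n. cos (2 * pi * real_of_int (int k) * real l / real n))"
    by simp
  moreover have "cos (2 * pi * real_of_int (int k) * real n / real n) = 1"
    using assms by (simp add: cos_int_2pin[of "int k", simplified])
  ultimately have "(\<Sum>l=1..n. cos (2 * pi * real_of_int (int k) * real l / real n)) = 0"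
    by simp
  then have "(\<Sum>l=1..n. cos (pi * real k * real l / real n) ^ 2) = real n / 2"
    by (simp add: eq sum.distrib sum_divide_distrib[symmetric])
  then show ?thesis
    using assms by (simp add: power_divide sum_divide_distrib[symmetric] sum_distrib_right[symmetric])
qed

subsection \<open>Efron-Stein inequalities\<close>

lemma (in prob_space) integrable_bounded:
  fixes f :: "'a \<Rightarrow> real"
  assumes "f \<in> borel_measurable M" "\<And>x. \<bar>f x\<bar> \<le> B"
  shows "integrable M f"
  using assms by (intro integrable_const_bound[where B=B]) auto

lemma (in prob_space) integral_bounded:
  fixes f :: "'a \<Rightarrow> real"
  assumes "f \<in> borel_measurable M" "\<And>x. \<bar>f x\<bar> \<le> B"
  shows "\<bar>\<integral>x. f x \<partial>M\<bar> \<le> B"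
proof -
  have "\<bar>\<integral>x. f x \<partial>M\<bar> \<le> (\<integral>x. \<bar>f x\<bar> \<partial>M)"
    by (rule integral_abs_bound)
  also have "\<dots> \<le> B"
    using assms(1) by (intro integral_le_const integrable_bounded[where B=B]) (use assms in auto)
  finally show ?thesis .
qed

lemma (in prob_space) square_integral_le:
  fixes f :: "'a \<Rightarrow> real"
  assumes [measurable]: "f \<in> borel_measurable M" and "\<And>x. \<bar>f x\<bar> \<le> B"
  shows "(\<integral>x. f x \<partial>M)\<^sup>2 \<le> (\<integral>x. (f x)\<^sup>2 \<partial>M)"
proof -
  have "(f x)\<^sup>2 \<le> B\<^sup>2" for x
    using power_mono[OF assms(2), of x 2] by simp
  then have "integrable M (\<lambda>x. (f x)\<^sup>2)"
    by (intro integrable_bounded[where B="B\<^sup>2"]) auto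
  moreover have "integrable M f"
    using assms by (intro integrable_bounded[where B=B])
  ultimately show ?thesis
    using variance_eq variance_positive[of f] by fastforce
qed

lemma (in prob_space) variance_le_shifted:
  fixes f :: "'a \<Rightarrow> real"
  assumes [measurable]: "f \<in> borel_measurable M" and "\<And>x. \<bar>f x\<bar> \<le> B"
  shows "(\<integral>x. (f x)\<^sup>2 \<partial>M) - (\<integral>x. f x \<partial>M)\<^sup>2 \<le> (\<integral>x. (f x - c)\<^sup>2 \<partial>M)"
proof -
  have "(f x)\<^sup>2 \<le> B\<^sup>2" for x
    using power_mono[OF assms(2), of x 2] by simp
  then have "integrable M (\<lambda>x. (f x)\<^sup>2)"
    by (intro integrable_bounded[where B="B\<^sup>2"]) auto
  moreover have "integrable M f"
    using assms by (intro integrable_bounded[where B=B])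
  ultimately have "(\<integral>x. (f x - c)\<^sup>2 \<partial>M) = (\<integral>x. (f x)\<^sup>2 \<partial>M) - 2 * c * (\<integral>x. f x \<partial>M) + c\<^sup>2"
    by (simp add: power2_diff prob_space)
  moreover have "0 \<le> ((\<integral>x. f x \<partial>M) - c)\<^sup>2" by simp
  ultimately show ?thesis by (simp add: power2_diff algebra_simps)
qed

text \<open>
  Coordinates are reset to a fixed value instead of being resampled; this costs a factor 2 and
  avoids independent copies.
\<close>

lemma Efron_Stein:
  fixes M :: "'i \<Rightarrow> 'a measure" and G :: "('i \<Rightarrow> 'a) \<Rightarrow> real" and z :: "'i \<Rightarrow> 'a"
  assumes M: "\<And>i. prob_space (M i)" and "finite I" and z: "\<And>i. z i \<in> space (M i)"
    and "G \<in> borel_measurable (PiM I M)" and "\<And>x. \<bar>G x\<bar> \<le> B"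
  shows "(\<integral>x. (G x)\<^sup>2 \<partial>PiM I M) - (\<integral>x. G x \<partial>PiM I M)\<^sup>2
     \<le> (\<Sum>i\<in>I. \<integral>x. (G x - G (x(i := z i)))\<^sup>2 \<partial>PiM I M)"
  using assms(2,4,5)
proof (induction I arbitrary: G)
  case empty
  interpret P: prob_space "PiM {} M" by (intro prob_space_PiM M)
  have "(\<integral>x. f x \<partial>PiM {} M) = f (\<lambda>k. undefined)" for f :: "_ \<Rightarrow> real"
    by (subst Bochner_Integration.integral_cong[where g="\<lambda>_. f (\<lambda>k. undefined)"])
      (use P.prob_space in \<open>auto simp: space_PiM\<close>)
  then show ?case by simp
next
  case (insert i I G)
  interpret product_sigma_finite M
    by (simp add: product_sigma_finite_def M prob_space_imp_sigma_finite)
  note [measurable] = insert.prems(1)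
  have B: "\<bar>G x\<bar> \<le> B" for x by fact
  have sq: "u\<^sup>2 \<le> C\<^sup>2" if "\<bar>u\<bar> \<le> C" for u C :: real
    using power_mono[OF that, of 2] by simp
  have D: "\<bar>G x - G y\<bar> \<le> 2 * B" for x y
    using B[of x] B[of y] by linarith
  interpret P: prob_space "PiM I M" by (intro prob_space_PiM M)
  interpret PI: prob_space "PiM (insert i I) M" by (intro prob_space_PiM M)
  interpret Mi: prob_space "M i" by (rule M)
  interpret pair_sigma_finite "PiM I M" "M i" ..
  interpret PM: prob_space "PiM I M \<Otimes>\<^sub>M M i"
    by (rule prob_space_pair) (rule P.prob_space_axioms Mi.prob_space_axioms)+
  have up2 [measurable]: "(\<lambda>(x, y). x(i := y)) \<in> measurable (PiM I M \<Otimes>\<^sub>M M i) (PiM (insert i I) M)"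
    by measurable
  have upz [measurable]: "(\<lambda>x. x(j := z j)) \<in> measurable (PiM J M) (PiM J M)"
    if "j \<in> J" for j J
    using that z by (intro measurable_fun_upd[where J=J]) (auto simp: insert_absorb)
  have fub: "(\<integral>x. f x \<partial>PiM (insert i I) M) = (\<integral>y. \<integral>x. f (x(i := y)) \<partial>PiM I M \<partial>M i)"
    if [measurable]: "f \<in> borel_measurable (PiM (insert i I) M)" and "\<And>x. \<bar>f x\<bar> \<le> C" for f :: "_ \<Rightarrow> real" and C
  proof -
    have "integrable (PiM I M \<Otimes>\<^sub>M M i) (\<lambda>(x, y). f (x(i := y)))"
      using that(2) by (intro PM.integrable_bounded[where B=C]) auto
    from Fubini_integral[OF this] show ?thesis
      using product_integral_insert[OF insert.hyps PI.integrable_bounded[OF that]] by simp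
  qed
  have inner_m: "(\<lambda>y. \<integral>x. f (x(i := y)) \<partial>PiM I M) \<in> borel_measurable (M i)"
    if [measurable]: "f \<in> borel_measurable (PiM (insert i I) M)" for f :: "_ \<Rightarrow> real"
    by measurable
  have slice_m: "(\<lambda>x. f (x(i := y))) \<in> borel_measurable (PiM I M)"
    if [measurable]: "f \<in> borel_measurable (PiM (insert i I) M)" and y: "y \<in> space (M i)" for f :: "_ \<Rightarrow> real" and y
    using y by measurable
  have inner_int: "integrable (M i) (\<lambda>y. \<integral>x. f (x(i := y)) \<partial>PiM I M)"
    if [measurable]: "f \<in> borel_measurable (PiM (insert i I) M)" and "\<And>x. \<bar>f x\<bar> \<le> C" for f :: "_ \<Rightarrow> real" and C
    using that(2) slice_m[OF that(1)] inner_m[OF that(1)]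
    by (intro Mi.integrable_const_bound[where B=C] AE_I2) (auto intro!: P.integral_bounded)
  define g where "g y = (\<integral>x. G (x(i := y)) \<partial>PiM I M)" for y
  define q where "q y = (\<integral>x. (G (x(i := y)))\<^sup>2 \<partial>PiM I M)" for y
  define d where "d j y = (\<integral>x. (G (x(i := y)) - G ((x(i := y))(j := z j)))\<^sup>2 \<partial>PiM I M)" for j y
  have G2: "\<bar>(G x)\<^sup>2\<bar> \<le> B\<^sup>2" for x using sq[OF B[of x]] by simp
  have D2: "\<bar>(G x - G y)\<^sup>2\<bar> \<le> (2*B)\<^sup>2" for x y using sq[OF D[of x y]] by simp
  have dm: "(\<lambda>x. (G x - G (x(j := z j)))\<^sup>2) \<in> borel_measurable (PiM (insert i I) M)" if "j \<in> insert i I" for j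
    using that by measurable
  have g_m [measurable]: "g \<in> borel_measurable (M i)"
    unfolding g_def by (rule inner_m) measurable
  have q_int: "integrable (M i) q"
    unfolding q_def by (rule inner_int[OF _ G2]) measurable
  have d_int: "integrable (M i) (d j)" if "j \<in> insert i I" for j
    unfolding d_def by (rule inner_int[OF dm[OF that] D2])
  have g_B: "\<bar>g y\<bar> \<le> B" if "y \<in> space (M i)" for y
    unfolding g_def by (rule P.integral_bounded[OF slice_m[OF _ that] B]) measurable
  define h where "h y = (if y \<in> space (M i) then g y else 0)" for y
  have h_m [measurable]: "h \<in> borel_measurable (M i)"
    unfolding h_def by measurable
  have h_B: "\<bar>h y\<bar> \<le> B" for y
    using g_B[of y] B[of undefined] by (auto simp: h_def)
  have h_int: "integrable (M i) (\<lambda>y. (h y)\<^sup>2)"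
    by (rule Mi.integrable_bounded[where B="B\<^sup>2"]) (use sq[OF h_B] in auto)
  have gh: "(\<integral>y. g y \<partial>M i) = (\<integral>y. h y \<partial>M i)"
    by (rule Bochner_Integration.integral_cong) (auto simp: h_def)
  have EG2: "(\<integral>x. (G x)\<^sup>2 \<partial>PiM (insert i I) M) = (\<integral>y. q y \<partial>M i)"
    unfolding q_def by (rule fub[OF _ G2]) measurable
  have EG: "(\<integral>x. G x \<partial>PiM (insert i I) M) = (\<integral>y. g y \<partial>M i)"
    unfolding g_def by (rule fub[OF _ B]) measurable
  have Ed: "(\<integral>x. (G x - G (x(j := z j)))\<^sup>2 \<partial>PiM (insert i I) M) = (\<integral>y. d j y \<partial>M i)" if "j \<in> insert i I" for j
    unfolding d_def by (rule fub[OF dm[OF that] D2])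
  have IH: "q y - (h y)\<^sup>2 \<le> (\<Sum>j\<in>I. d j y)" if "y \<in> space (M i)" for y
  proof -
    have "q y - (g y)\<^sup>2 \<le> (\<Sum>j\<in>I. \<integral>x. (G (x(i := y)) - G ((x(j := z j))(i := y)))\<^sup>2 \<partial>PiM I M)"
      unfolding q_def g_def by (rule insert.IH[OF slice_m[OF _ that] B]) measurable
    also have "\<dots> = (\<Sum>j\<in>I. d j y)"
    proof (rule sum.cong[OF refl])
      fix j assume "j \<in> I"
      then have "j \<noteq> i" using insert.hyps by auto
      then show "(\<integral>x. (G (x(i := y)) - G ((x(j := z j))(i := y)))\<^sup>2 \<partial>PiM I M) = d j y"
        by (simp add: d_def fun_upd_twist[of j i])
    qed
    finally show ?thesis using that by (simp add: h_def)
  qed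
  have "(\<integral>y. q y \<partial>M i) - (\<integral>y. (h y)\<^sup>2 \<partial>M i) = (\<integral>y. q y - (h y)\<^sup>2 \<partial>M i)"
    using q_int h_int by simp
  also have "\<dots> \<le> (\<integral>y. (\<Sum>j\<in>I. d j y) \<partial>M i)"
    using q_int h_int d_int IH by (intro integral_mono) auto
  also have "\<dots> = (\<Sum>j\<in>I. \<integral>y. d j y \<partial>M i)"
    using d_int by (intro Bochner_Integration.integral_sum) auto
  finally have 1: "(\<integral>y. q y \<partial>M i) - (\<integral>y. (h y)\<^sup>2 \<partial>M i) \<le> (\<Sum>j\<in>I. \<integral>y. d j y \<partial>M i)" .
  have "(\<integral>y. (h y)\<^sup>2 \<partial>M i) - (\<integral>y. h y \<partial>M i)\<^sup>2 \<le> (\<integral>y. (h y - g (z i))\<^sup>2 \<partial>M i)"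
    by (rule Mi.variance_le_shifted[OF h_m h_B])
  also have "\<dots> \<le> (\<integral>y. d i y \<partial>M i)"
  proof (rule integral_mono)
    have "\<bar>h y - g (z i)\<bar> \<le> 2 * B" for y using h_B[of y] g_B[OF z[of i]] by linarith
    then show "integrable (M i) (\<lambda>y. (h y - g (z i))\<^sup>2)"
      using sq[of _ "2*B"] by (intro Mi.integrable_bounded[where B="(2*B)\<^sup>2"]) (auto simp del: power_mult_distrib)
    show "integrable (M i) (d i)" using d_int by simp
    fix y assume y: "y \<in> space (M i)"
    have int: "integrable (PiM I M) (\<lambda>x. G (x(i := u)))" if "u \<in> space (M i)" for u
      by (rule P.integrable_bounded[OF slice_m[OF _ that] B]) measurable
    have "h y - g (z i) = (\<integral>x. G (x(i := y)) - G (x(i := z i)) \<partial>PiM I M)"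
      using y int[OF y] int[OF z] by (simp add: h_def g_def)
    also have "\<dots>\<^sup>2 \<le> (\<integral>x. (G (x(i := y)) - G (x(i := z i)))\<^sup>2 \<partial>PiM I M)"
      using int[OF y] int[OF z]
      by (intro P.square_integral_le[OF _ D] borel_measurable_diff borel_measurable_integrable)
    also have "\<dots> = d i y" by (simp add: d_def)
    finally show "(h y - g (z i))\<^sup>2 \<le> d i y" .
  qed
  finally show ?case
    using 1 insert.hyps by (simp add: EG2 EG Ed gh del: fun_upd_apply)
qed

lemma Efron_Stein_fourth_moment:
  fixes M :: "'i \<Rightarrow> 'a measure" and G :: "('i \<Rightarrow> 'a) \<Rightarrow> real" and z :: "'i \<Rightarrow> 'a"
  assumes M: "\<And>i. prob_space (M i)" and fin: "finite I" and z: "\<And>i. z i \<in> space (M i)"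
    and G_m [measurable]: "G \<in> borel_measurable (PiM I M)" and G_B: "\<And>x. \<bar>G x\<bar> \<le> B"
  defines "m \<equiv> \<integral>x. G x \<partial>PiM I M"
  shows "(\<integral>x. (G x - m) ^ 4 \<partial>PiM I M)
     \<le> 70 * (\<integral>x. (\<Sum>i\<in>I. (G x - G (x(i := z i)))\<^sup>2)\<^sup>2 \<partial>PiM I M)"
proof -
  interpret P: prob_space "PiM I M" by (intro prob_space_PiM M)
  have upz [measurable]: "(\<lambda>x. x(j := z j)) \<in> measurable (PiM I M) (PiM I M)"
    if "j \<in> I" for j
    using that z by (intro measurable_fun_upd[where J=I]) (auto simp: insert_absorb)
  have sq: "u ^ k \<le> C ^ k" "\<bar>u\<bar> ^ k \<le> C ^ k" if "\<bar>u\<bar> \<le> C" for u C :: real and k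
    using power_mono[OF that, of k] power_abs[of u k] by auto
  define Z where "Z x = G x - m" for x
  have m_B: "\<bar>m\<bar> \<le> B" unfolding m_def by (rule P.integral_bounded[OF G_m G_B])
  have Z_m [measurable]: "Z \<in> borel_measurable (PiM I M)" unfolding Z_def by measurable
  have Z_B: "\<bar>Z x\<bar> \<le> 2 * B" for x using m_B G_B[of x] unfolding Z_def by linarith
  define W where "W x = (\<Sum>i\<in>I. (Z x - Z (x(i := z i)))\<^sup>2)" for x
  have W_m [measurable]: "W \<in> borel_measurable (PiM I M)" unfolding W_def by measurable
  have W0: "0 \<le> W x" for x unfolding W_def by (simp add: sum_nonneg)
  have W_B: "\<bar>W x\<bar> \<le> real (card I) * (4*B)\<^sup>2" for x
  proof -
    have "\<bar>Z x - Z y\<bar> \<le> 4 * B" for y using Z_B[of x] Z_B[of y] by linarith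
    then have "W x \<le> (\<Sum>i\<in>I. (4*B)\<^sup>2)" unfolding W_def
      by (intro sum_mono sq)
    then show ?thesis using W0[of x] by simp
  qed
  have int: "integrable (PiM I M) (\<lambda>x. (Z x)\<^sup>2)" "integrable (PiM I M) (\<lambda>x. Z x ^ 4)" "integrable (PiM I M) Z"
    subgoal using sq(1)[OF Z_B, of _ 2] by (intro P.integrable_bounded[where B="(2*B)^2"]) auto
    subgoal using sq(1)[OF Z_B, of _ 4] by (intro P.integrable_bounded[where B="(2*B)^4"]) auto
    subgoal using Z_B by (intro P.integrable_bounded[where B="2*B"]) auto
    done
  have intW: "integrable (PiM I M) (\<lambda>x. (W x)\<^sup>2)" "integrable (PiM I M) W"
    subgoal using sq(1)[OF W_B, of _ 2] by (intro P.integrable_bounded[where B="(real (card I) * (4*B)\<^sup>2)\<^sup>2"]) auto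
    subgoal using W_B by (intro P.integrable_bounded[where B="real (card I) * (4*B)\<^sup>2"]) auto
    done
  have intd: "integrable (PiM I M) (\<lambda>x. (f x - f (x(i := z i)))\<^sup>2)" if "i \<in> I" 
    and [measurable]: "f \<in> borel_measurable (PiM I M)" and f: "\<And>x. \<bar>f x\<bar> \<le> C" for i C and f :: "_ \<Rightarrow> real"
  proof (rule P.integrable_bounded[where B="(2*C)\<^sup>2"])
    show "\<bar>(f x - f (x(i := z i)))\<^sup>2\<bar> \<le> (2*C)\<^sup>2" for x
      using sq(1)[of "f x - f (x(i := z i))" "2*C" 2] f[of x] f[of "x(i := z i)"] by simp
  qed (use that in measurable)
  have "(\<integral>x. Z x \<partial>PiM I M) = 0"
    using P.integrable_bounded[OF G_m G_B] by (simp add: Z_def m_def P.prob_space)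
  then have "(\<integral>x. (Z x)\<^sup>2 \<partial>PiM I M) \<le> (\<Sum>i\<in>I. \<integral>x. (Z x - Z (x(i := z i)))\<^sup>2 \<partial>PiM I M)"
    using Efron_Stein[where M=M, OF M fin z Z_m Z_B] by simp
  also have "\<dots> = (\<integral>x. W x \<partial>PiM I M)"
    unfolding W_def using intd[OF _ Z_m Z_B] by (intro Bochner_Integration.integral_sum[symmetric])
  finally have "(\<integral>x. (Z x)\<^sup>2 \<partial>PiM I M)\<^sup>2 \<le> (\<integral>x. W x \<partial>PiM I M)\<^sup>2"
    by (intro power_mono) auto
  also have "\<dots> \<le> (\<integral>x. (W x)\<^sup>2 \<partial>PiM I M)"
    by (rule P.square_integral_le[OF W_m W_B])
  finally have 1: "(\<integral>x. (Z x)\<^sup>2 \<partial>PiM I M)\<^sup>2 \<le> (\<integral>x. (W x)\<^sup>2 \<partial>PiM I M)" .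
  have Z2_m: "(\<lambda>x. (Z x)\<^sup>2) \<in> borel_measurable (PiM I M)" by measurable
  have Z2_B: "\<bar>(Z x)\<^sup>2\<bar> \<le> (2*B)\<^sup>2" for x using sq[OF Z_B, of x 2] by simp
  have "(\<integral>x. ((Z x)\<^sup>2)\<^sup>2 \<partial>PiM I M) - (\<integral>x. (Z x)\<^sup>2 \<partial>PiM I M)\<^sup>2
      \<le> (\<Sum>i\<in>I. \<integral>x. ((Z x)\<^sup>2 - (Z (x(i := z i)))\<^sup>2)\<^sup>2 \<partial>PiM I M)"
    by (rule Efron_Stein[OF M fin z Z2_m Z2_B])
  also have "\<dots> = (\<integral>x. (\<Sum>i\<in>I. ((Z x)\<^sup>2 - (Z (x(i := z i)))\<^sup>2)\<^sup>2) \<partial>PiM I M)"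
    using intd[OF _ Z2_m Z2_B] by (intro Bochner_Integration.integral_sum[symmetric])
  also have "\<dots> \<le> (\<integral>x. Z x ^ 4 / 2 + 34 * (W x)\<^sup>2 \<partial>PiM I M)"
  proof (rule integral_mono)
    show "integrable (PiM I M) (\<lambda>x. \<Sum>i\<in>I. ((Z x)\<^sup>2 - (Z (x(i := z i)))\<^sup>2)\<^sup>2)"
      using intd[OF _ Z2_m Z2_B] by (rule Bochner_Integration.integrable_sum)
    show "integrable (PiM I M) (\<lambda>x. Z x ^ 4 / 2 + 34 * (W x)\<^sup>2)"
      using int intW by simp
    fix x
    have "((Z x)\<^sup>2 - (Z (x(i := z i)))\<^sup>2)\<^sup>2 \<le> (8 * (Z x)\<^sup>2 + 2 * W x) * (Z x - Z (x(i := z i)))\<^sup>2" if "i \<in> I" for i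
    proof -
      define a where "a = Z x"
      define b where "b = Z (x(i := z i))"
      have "(a - b)\<^sup>2 \<le> W x"
        unfolding W_def a_def b_def using fin that by (intro member_le_sum) auto
      moreover have "0 \<le> (2 * a + (a - b))\<^sup>2" by simp
      then have "(a + b)\<^sup>2 \<le> 8 * a\<^sup>2 + 2 * (a - b)\<^sup>2"
        by (simp add: power2_eq_square algebra_simps)
      ultimately have "(a + b)\<^sup>2 * (a - b)\<^sup>2 \<le> (8 * a\<^sup>2 + 2 * W x) * (a - b)\<^sup>2"
        by (intro mult_right_mono) auto
      then show ?thesis unfolding a_def[symmetric] b_def[symmetric]
        by (simp add: power2_eq_square algebra_simps)
    qed
    then have "(\<Sum>i\<in>I. ((Z x)\<^sup>2 - (Z (x(i := z i)))\<^sup>2)\<^sup>2) \<le> (\<Sum>i\<in>I. (8 * (Z x)\<^sup>2 + 2 * W x) * (Z x - Z (x(i := z i)))\<^sup>2)"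
      by (rule sum_mono)
    also have "\<dots> = (8 * (Z x)\<^sup>2 + 2 * W x) * W x" unfolding W_def by (simp only: sum_distrib_left)
    also have "\<dots> \<le> Z x ^ 4 / 2 + 34 * (W x)\<^sup>2"
    proof -
      have "0 \<le> ((Z x)\<^sup>2 - 8 * W x)\<^sup>2" by simp
      moreover have "((Z x)\<^sup>2)\<^sup>2 = Z x ^ 4" by simp
      ultimately show ?thesis by (simp add: power2_diff algebra_simps power2_eq_square[of "W x"])
    qed
    finally show "(\<Sum>i\<in>I. ((Z x)\<^sup>2 - (Z (x(i := z i)))\<^sup>2)\<^sup>2) \<le> Z x ^ 4 / 2 + 34 * (W x)\<^sup>2" .
  qed
  also have "\<dots> = (\<integral>x. Z x ^ 4 \<partial>PiM I M) / 2 + 34 * (\<integral>x. (W x)\<^sup>2 \<partial>PiM I M)"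
    using int intW by simp
  finally have "(\<integral>x. Z x ^ 4 \<partial>PiM I M) \<le> 70 * (\<integral>x. (W x)\<^sup>2 \<partial>PiM I M)"
    using 1 by simp
  then show ?thesis by (simp add: Z_def W_def)
qed

subsection \<open>Concentration of empirical means\<close>

definition emp_mean :: "(real \<Rightarrow> real) \<Rightarrow> nat \<Rightarrow> (nat \<Rightarrow> real) \<Rightarrow> real" where
  "emp_mean f n \<omega> = 1 / real n * (\<Sum>k=1..n. f (S n k \<omega>))"

lemma S_eq: "S n k \<omega> = (\<Sum>l=1..n. \<omega> l * (cos (pi * real k * real l / real n) / sqrt (real n / 2)))"
  by (simp add: S_def X_def sum_distrib_left mult.commute)

lemma S_cong: "(\<And>l. l \<in> {1..n} \<Longrightarrow> \<omega> l = \<omega>' l) \<Longrightarrow> S n k \<omega> = S n k \<omega>'"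
  unfolding S_eq by (intro sum.cong) auto

lemma S_upd_zero:
  assumes "l \<in> {1..n}"
  shows "S n k (x(l := 0)) = S n k x - x l * (cos (pi * real k * real l / real n) / sqrt (real n / 2))"
proof -
  define c where "c j = cos (pi * real k * real j / real n) / sqrt (real n / 2)" for j
  have "(\<Sum>j=1..n. (x(l := 0)) j * c j) = (\<Sum>j=1..n. x j * c j - (if j = l then x l * c l else 0))"
    by (intro sum.cong) auto
  also have "\<dots> = (\<Sum>j=1..n. x j * c j) - x l * c l"
    using assms by (simp add: sum_subtractf)
  finally show ?thesis unfolding S_eq c_def .
qed

lemma cos_coeff_squared_le: "(cos a / sqrt (real n / 2))\<^sup>2 \<le> 2 / real n"
  by (simp add: power_divide abs_square_le_1 divide_right_mono)

lemma emp_mean_influence_le: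
  fixes f f' :: "real \<Rightarrow> real"
  assumes L: "\<And>u. \<bar>f' u\<bar> \<le> L" and K: "\<And>u v. \<bar>f v - f u - f' u * (v - u)\<bar> \<le> K * (v - u)\<^sup>2"
    and n: "1 \<le> n"
  shows "(\<Sum>l\<in>{1..n}. (emp_mean f n x - emp_mean f n (x(l := 0)))\<^sup>2)\<^sup>2
    \<le> (64 * L ^ 4 + 128 * K ^ 4) / (real n * sqrt (real n)) * (1 + (\<Sum>l=1..n. x l ^ 8) / real n)"
proof -
  define N where "N = real n"
  have N: "N \<ge> 1" "N > 0" using n by (auto simp: N_def)
  define c where "c k l = cos (pi * real k * real l / real n) / sqrt (real n / 2)" for k l :: nat
  have K0: "0 \<le> K" using K[of 1 0] by simp
  define g where "g l = (\<Sum>k=1..n. f' (S n k x) * c k l) / N" for l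
  define Q where "Q = (\<Sum>l=1..n. x l ^ 8)"
  define M where "M = (sqrt N + Q / sqrt N) / 2"
  have Q0: "0 \<le> Q" unfolding Q_def by (intro sum_nonneg) auto
  have g: "(\<Sum>l=1..n. (g l)\<^sup>2) \<le> 4 * L\<^sup>2 / N"
  proof -
    have "(g l)\<^sup>2 = 2 / N ^ 3 * (\<Sum>k=1..n. f' (S n k x) * cos (pi * real k * real l / real n))\<^sup>2" for l
    proof -
      have "g l = (\<Sum>k=1..n. f' (S n k x) * cos (pi * real k * real l / real n)) / sqrt (N / 2) / N"
        unfolding g_def c_def N_def by (simp add: sum_divide_distrib)
      moreover have "(a / sqrt (N / 2) / N)\<^sup>2 = 2 / N ^ 3 * a\<^sup>2" for a
        using N by (simp add: power_divide power_mult_distrib power3_eq_cube power2_eq_square[of N] mult.assoc)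
      ultimately show ?thesis by (simp only:)
    qed
    then have "(\<Sum>l=1..n. (g l)\<^sup>2) = 2 / N ^ 3 * (\<Sum>l=1..n. (\<Sum>k=1..n. f' (S n k x) * cos (pi * real k * real l / real n))\<^sup>2)"
      by (simp add: sum_distrib_left)
    also have "\<dots> \<le> 2 / N ^ 3 * (2 * real n * (\<Sum>k=1..n. (f' (S n k x))\<^sup>2))"
      using N by (intro mult_left_mono sum_cos_transform_squared_le) auto
    also have "\<dots> \<le> 2 / N ^ 3 * (2 * real n * (\<Sum>k=1..n. L\<^sup>2))"
      using N power_mono[OF L, where n=2] by (intro mult_left_mono sum_mono) auto
    also have "\<dots> = 4 * L\<^sup>2 / N"
      using N unfolding N_def by (simp add: power3_eq_cube field_simps power2_eq_square)
    finally show ?thesis .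
  qed
  \<comment> \<open>AM-GM for \<open>sqrt N\<close> and the fourth power of \<open>x l\<close>\<close>
  have x4: "(x l)\<^sup>2 \<le> sqrt M" if "l \<in> {1..n}" for l
  proof -
    have "x l ^ 8 \<le> Q" unfolding Q_def using that by (intro member_le_sum) auto
    moreover have "0 \<le> (sqrt N - x l ^ 4)\<^sup>2" by simp
    then have "2 * sqrt N * x l ^ 4 \<le> N + x l ^ 8"
      using N by (simp add: power2_diff)
    ultimately have "2 * sqrt N * x l ^ 4 \<le> N + Q" by linarith
    then have "x l ^ 4 \<le> (N + Q) / (2 * sqrt N)" using N by (simp add: field_simps)
    also have "\<dots> = M" unfolding M_def using N real_div_sqrt[of N] by (simp add: add_divide_distrib)
    finally have "((x l)\<^sup>2)\<^sup>2 \<le> M" by simp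
    then show ?thesis by (rule real_le_rsqrt)
  qed
  have diff: "(emp_mean f n x - emp_mean f n (x(l := 0)))\<^sup>2 \<le> 2 * ((x l)\<^sup>2 * (g l)\<^sup>2) + 8 * K\<^sup>2 / N\<^sup>2 * x l ^ 4"
    if l: "l \<in> {1..n}" for l
  proof -
    define e where "e k = f (S n k x) - f (S n k x - x l * c k l) - f' (S n k x) * (x l * c k l)" for k
    have e: "\<bar>e k\<bar> \<le> 2 * K * (x l)\<^sup>2 / N" for k
    proof -
      have "\<bar>e k\<bar> \<le> K * (x l * c k l)\<^sup>2"
        using K[of "S n k x - x l * c k l" "S n k x"] by (simp add: e_def)
      also have "\<dots> \<le> K * ((x l)\<^sup>2 * (2 / N))"
        unfolding power_mult_distrib c_def N_def
        using K0 by (intro mult_left_mono cos_coeff_squared_le) auto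
      finally show ?thesis by (simp add: algebra_simps)
    qed
    have "emp_mean f n x = (\<Sum>k=1..n. f (S n k x)) / N"
      "emp_mean f n (x(l := 0)) = (\<Sum>k=1..n. f (S n k x - x l * c k l)) / N"
      unfolding emp_mean_def S_upd_zero[OF l] c_def N_def by simp_all
    moreover have "x l * g l = (\<Sum>k=1..n. f' (S n k x) * (x l * c k l)) / N"
      unfolding g_def by (simp add: sum_distrib_left mult.left_commute)
    ultimately have "emp_mean f n x - emp_mean f n (x(l := 0)) - x l * g l = (\<Sum>k=1..n. e k) / N"
      by (simp only: e_def sum_subtractf diff_divide_distrib)
    also have "\<bar>\<dots>\<bar> \<le> (\<Sum>k=1..n. \<bar>e k\<bar>) / N" using N by (simp add: divide_right_mono)
    also have "\<dots> \<le> (\<Sum>k=1..n. 2 * K * (x l)\<^sup>2 / N) / N"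
      using N by (intro divide_right_mono sum_mono e) auto
    also have "\<dots> = 2 * K * (x l)\<^sup>2 / N" using N by (simp add: N_def)
    finally have "\<bar>emp_mean f n x - emp_mean f n (x(l := 0)) - x l * g l\<bar> \<le> 2 * K * (x l)\<^sup>2 / N" .
    from power_mono[OF this, of 2]
    have r: "(emp_mean f n x - emp_mean f n (x(l := 0)) - x l * g l)\<^sup>2 \<le> 4 * K\<^sup>2 / N\<^sup>2 * x l ^ 4"
      by (simp add: power_divide power_mult_distrib)
    have sq: "(a + b)\<^sup>2 \<le> 2 * a\<^sup>2 + 2 * b\<^sup>2" for a b :: real
      using zero_le_power2[of "a - b"] by (simp add: power2_diff power2_sum)
    show ?thesis
      using sq[of "x l * g l" "emp_mean f n x - emp_mean f n (x(l := 0)) - x l * g l"] r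
      by (simp add: power_mult_distrib)
  qed
  define V where "V = (\<Sum>l\<in>{1..n}. (emp_mean f n x - emp_mean f n (x(l := 0)))\<^sup>2)"
  define q where "q = (\<Sum>l=1..n. x l ^ 4)"
  have V0: "0 \<le> V" unfolding V_def by (intro sum_nonneg) auto
  have M0: "0 \<le> M" using Q0 N by (simp add: M_def)
  have "V \<le> (\<Sum>l=1..n. 2 * ((x l)\<^sup>2 * (g l)\<^sup>2) + 8 * K\<^sup>2 / N\<^sup>2 * x l ^ 4)"
    unfolding V_def by (intro sum_mono diff)
  also have "\<dots> \<le> (\<Sum>l=1..n. 2 * (sqrt M * (g l)\<^sup>2) + 8 * K\<^sup>2 / N\<^sup>2 * x l ^ 4)"
    by (intro sum_mono add_mono mult_left_mono mult_right_mono x4) auto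
  also have "\<dots> = 2 * sqrt M * (\<Sum>l=1..n. (g l)\<^sup>2) + 8 * K\<^sup>2 / N\<^sup>2 * q"
    by (simp add: q_def sum.distrib sum_distrib_left mult.assoc)
  also have "\<dots> \<le> 2 * sqrt M * (4 * L\<^sup>2 / N) + 8 * K\<^sup>2 / N\<^sup>2 * q"
    using M0 by (intro add_right_mono mult_left_mono g) auto
  finally have "V\<^sup>2 \<le> (2 * sqrt M * (4 * L\<^sup>2 / N) + 8 * K\<^sup>2 / N\<^sup>2 * q)\<^sup>2"
    using V0 by (intro power_mono)
  also have "\<dots> \<le> 2 * (2 * sqrt M * (4 * L\<^sup>2 / N))\<^sup>2 + 2 * (8 * K\<^sup>2 / N\<^sup>2 * q)\<^sup>2"
    using zero_le_power2[of "2 * sqrt M * (4 * L\<^sup>2 / N) - 8 * K\<^sup>2 / N\<^sup>2 * q"]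
    unfolding power2_diff power2_sum by linarith
  also have "\<dots> = 128 * L ^ 4 * M / N\<^sup>2 + 128 * K ^ 4 / N ^ 4 * q\<^sup>2"
    using M0 by (simp add: power_mult_distrib power_divide mult_ac)
  also have "\<dots> \<le> 64 * L ^ 4 / (N * sqrt N) * (1 + Q / N) + 128 * K ^ 4 / (N * sqrt N) * (1 + Q / N)"
  proof (rule add_mono)
    have "sqrt N * sqrt N = N" using N by simp
    then have "M / N\<^sup>2 = (1 + Q / N) / (2 * (N * sqrt N))"
      unfolding M_def using N by (simp add: power2_eq_square divide_simps)
    then have "128 * L ^ 4 * (M / N\<^sup>2) = 64 * L ^ 4 / (N * sqrt N) * (1 + Q / N)" by simp
    then show "128 * L ^ 4 * M / N\<^sup>2 \<le> 64 * L ^ 4 / (N * sqrt N) * (1 + Q / N)" by simp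
    have "q\<^sup>2 \<le> N * Q"
      using sum_squared_le_sum_of_squares[of "\<lambda>l. x l ^ 4" "{1..n}"]
      unfolding q_def Q_def N_def by (simp add: mult.commute)
    then have "128 * K ^ 4 / N ^ 4 * q\<^sup>2 \<le> 128 * K ^ 4 / N ^ 4 * (N * Q)"
      by (intro mult_left_mono) (use N in auto)
    also have "\<dots> = 128 * K ^ 4 / (N * N) * (Q / N)"
      using N by (simp add: power4_eq_xxxx)
    also have "\<dots> \<le> 128 * K ^ 4 / (N * sqrt N) * (1 + Q / N)"
    proof (rule mult_mono)
      have "sqrt N \<le> N" using N real_sqrt_le_mono[of N "N * N"] by simp
      then show "128 * K ^ 4 / (N * N) \<le> 128 * K ^ 4 / (N * sqrt N)"
        using N by (intro divide_left_mono mult_left_mono) auto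
    qed (use N Q0 in auto)
    finally show "128 * K ^ 4 / N ^ 4 * q\<^sup>2 \<le> 128 * K ^ 4 / (N * sqrt N) * (1 + Q / N)" .
  qed
  also have "\<dots> = (64 * L ^ 4 + 128 * K ^ 4) / (N * sqrt N) * (1 + Q / N)"
    by (simp add: add_divide_distrib distrib_right)
  finally show ?thesis by (simp add: V_def N_def Q_def)
qed

lemma S_measurable [measurable]:
  assumes [measurable_cong]: "sets D = sets borel" and "{1..n} \<subseteq> J"
  shows "S n k \<in> borel_measurable (PiM J (\<lambda>_. D))"
proof -
  have "(\<lambda>\<omega>. \<omega> l) \<in> borel_measurable (PiM J (\<lambda>_. D))" if "l \<in> {1..n}" for l
  proof -
    have [simp]: "l \<in> J" using that assms(2) by auto
    show ?thesis by measurable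
  qed
  then show ?thesis
    unfolding S_def X_def by measurable
qed

lemma integral_PiM_restrict:
  fixes f :: "('i \<Rightarrow> 'a) \<Rightarrow> real"
  assumes "\<And>i. prob_space (M i)" "finite J" "J \<subseteq> I" and f [measurable]: "f \<in> borel_measurable (PiM J M)"
    and cong: "\<And>x y. (\<And>i. i \<in> J \<Longrightarrow> x i = y i) \<Longrightarrow> f x = f y"
  shows "(\<integral>x. f x \<partial>PiM I M) = (\<integral>x. f x \<partial>PiM J M)"
proof -
  interpret product_prob_space M I
    by (intro product_prob_spaceI assms(1))
  have "(\<integral>x. f x \<partial>PiM J M) = (\<integral>x. f x \<partial>distr (PiM I M) (PiM J M) (\<lambda>x. restrict x J))"
    by (simp add: distr_PiM_restrict_finite assms(1-3))
  also have "\<dots> = (\<integral>x. f (restrict x J) \<partial>PiM I M)"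
    using assms(3) by (intro integral_distr measurable_restrict_subset f)
  also have "\<dots> = (\<integral>x. f x \<partial>PiM I M)"
    by (intro Bochner_Integration.integral_cong refl cong) auto
  finally show ?thesis by simp
qed

lemma emp_mean_concentration:
  fixes f f' :: "real \<Rightarrow> real"
  assumes D: "prob_space D" and sets: "sets D = sets borel" and D8: "integrable D (\<lambda>x. x ^ 8)"
    and f_m [measurable]: "f \<in> borel_measurable borel" and B: "\<And>x. \<bar>f x\<bar> \<le> B"
    and L: "\<And>x. \<bar>f' x\<bar> \<le> L" and K: "\<And>x y. \<bar>f y - f x - f' x * (y - x)\<bar> \<le> K * (y - x)\<^sup>2"
  defines "P \<equiv> PiM {1::nat..} (\<lambda>_. D)"
  shows "AE \<omega> in P. (\<lambda>n. emp_mean f n \<omega> - (\<integral>\<omega>. emp_mean f n \<omega> \<partial>P)) \<longlonglongrightarrow> 0"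
proof -
  interpret D: prob_space D by fact
  interpret P: prob_space P unfolding P_def by (intro prob_space_PiM D)
  define C where "C = 70 * ((64 * L ^ 4 + 128 * K ^ 4) * (1 + (\<integral>x. x ^ 8 \<partial>D)))"
  have emp_meas: "emp_mean f n \<in> borel_measurable (PiM J (\<lambda>_. D))" if "{1..n} \<subseteq> J" for n J
    using S_measurable[OF sets that] unfolding emp_mean_def by measurable
  have [measurable]: "emp_mean f n \<in> borel_measurable P" for n
    unfolding P_def by (rule emp_meas) auto
  have emp_B: "\<bar>emp_mean f n \<omega>\<bar> \<le> B" for n \<omega>
  proof (cases "n = 0")
    case True then show ?thesis using B[of 0] by (simp add: emp_mean_def)
  next
    case False
    have "\<bar>emp_mean f n \<omega>\<bar> \<le> (\<Sum>k=1..n. \<bar>f (S n k \<omega>)\<bar>) / real n"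
      by (simp add: emp_mean_def abs_mult divide_right_mono)
    also have "\<dots> \<le> (\<Sum>k=1..n. B) / real n" by (intro divide_right_mono sum_mono B) auto
    finally show ?thesis using False by simp
  qed
  have cong: "emp_mean f n x = emp_mean f n y" if "\<And>i. i \<in> {1..n} \<Longrightarrow> x i = y i" for n x y
    using S_cong[of n x y] that unfolding emp_mean_def by (metis (no_types, lifting))
  define m where "m n = (\<integral>\<omega>. emp_mean f n \<omega> \<partial>P)" for n
  have 4: "(\<integral>\<omega>. (emp_mean f n \<omega> - m n) ^ 4 \<partial>P) \<le> C / (real n * sqrt (real n))" if n: "1 \<le> n" for n
  proof -
    let ?J = "{1..n}" and ?P = "PiM {1..n} (\<lambda>_. D)"
    interpret J: prob_space ?P by (intro prob_space_PiM D)
    have emp_n [measurable]: "emp_mean f n \<in> borel_measurable ?P" by (rule emp_meas) auto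
    have upz [measurable]: "(\<lambda>x. x(l := 0)) \<in> measurable ?P ?P" if "l \<in> ?J" for l
      using that sets_eq_imp_space_eq[OF sets] by (intro measurable_fun_upd[where J="?J"]) (auto simp: insert_absorb)
    have m: "m n = (\<integral>\<omega>. emp_mean f n \<omega> \<partial>?P)"
      unfolding m_def P_def by (rule integral_PiM_restrict[OF D]) (auto intro: cong emp_meas)
    have x8: "integrable ?P (\<lambda>x. x l ^ 8)" "(\<integral>x. x l ^ 8 \<partial>?P) = (\<integral>x. x ^ 8 \<partial>D)" if "l \<in> ?J" for l
    proof -
      have eq: "distr ?P D (\<lambda>x. x l) = D" using distr_PiM_component[of ?J "\<lambda>_. D" l] that D by simp
      have [measurable]: "(\<lambda>x. x ^ 8) \<in> borel_measurable D" using D8 by auto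
      have "integrable (distr ?P D (\<lambda>x. x l)) (\<lambda>x. x ^ 8)" using D8 by (simp only: eq)
      then show "integrable ?P (\<lambda>x. x l ^ 8)" using that by (subst (asm) integrable_distr_eq) auto
      have "(\<integral>x. x ^ 8 \<partial>distr ?P D (\<lambda>x. x l)) = (\<integral>x. x l ^ 8 \<partial>?P)"
        using that by (intro integral_distr) auto
      then show "(\<integral>x. x l ^ 8 \<partial>?P) = (\<integral>x. x ^ 8 \<partial>D)" by (simp only: eq)
    qed
    define A where "A = (64 * L ^ 4 + 128 * K ^ 4) / (real n * sqrt (real n))"
    define Q where "Q x = (\<Sum>l=1..n. x l ^ 8) / real n" for x :: "nat \<Rightarrow> real"
    define W where "W x = (\<Sum>l\<in>?J. (emp_mean f n x - emp_mean f n (x(l := 0)))\<^sup>2)\<^sup>2" for x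
    have W_le: "W x \<le> A * (1 + Q x)" for x
      unfolding W_def A_def Q_def by (rule emp_mean_influence_le[OF L K n])
    have W_m: "W \<in> borel_measurable ?P" unfolding W_def by measurable
    have W_ge: "0 \<le> W x" for x unfolding W_def by simp
    have Q_int: "integrable ?P Q"
      unfolding Q_def using x8 by (intro integrable_divide Bochner_Integration.integrable_sum) auto
    have Q_eq: "(\<integral>x. Q x \<partial>?P) = (\<integral>x. x ^ 8 \<partial>D)"
      unfolding Q_def using x8 n by (simp add: Bochner_Integration.integral_sum)
    have R_int: "integrable ?P (\<lambda>x. A * (1 + Q x))"
      using Bochner_Integration.integrable_add[OF J.integrable_const Q_int] by (rule integrable_mult_right)
    have W_int: "integrable ?P W"
      using W_le W_ge by (intro Bochner_Integration.integrable_bound[OF R_int W_m] AE_I2)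
        (metis abs_ge_self abs_of_nonneg order_trans real_norm_def)
    have "(\<integral>\<omega>. (emp_mean f n \<omega> - m n) ^ 4 \<partial>P) = (\<integral>\<omega>. (emp_mean f n \<omega> - m n) ^ 4 \<partial>?P)"
      unfolding P_def
    proof (rule integral_PiM_restrict[OF D])
      show "(\<lambda>\<omega>. (emp_mean f n \<omega> - m n) ^ 4) \<in> borel_measurable ?P" by measurable
      show "(emp_mean f n x - m n) ^ 4 = (emp_mean f n y - m n) ^ 4" if "\<And>i. i \<in> ?J \<Longrightarrow> x i = y i" for x y
        using cong[OF that] by simp
    qed auto
    also have "\<dots> \<le> 70 * (\<integral>x. W x \<partial>?P)"
      unfolding m W_def using sets_eq_imp_space_eq[OF sets] emp_B
      by (intro Efron_Stein_fourth_moment D emp_n) auto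
    also have "\<dots> \<le> 70 * (\<integral>x. A * (1 + Q x) \<partial>?P)"
      using W_le by (intro mult_left_mono integral_mono W_int R_int) auto
    also have "\<dots> = 70 * (A * (1 + (\<integral>x. x ^ 8 \<partial>D)))"
      using Bochner_Integration.integral_add[OF J.integrable_const[of 1] Q_int] Q_eq J.prob_space by (simp del: One_nat_def)
    also have "\<dots> = C / (real n * sqrt (real n))" by (simp add: C_def A_def)
    finally show ?thesis .
  qed
  define Y where "Y n \<omega> = (emp_mean f n \<omega> - m n) ^ 4" for n \<omega>
  have Y0: "0 \<le> Y n \<omega>" for n \<omega> unfolding Y_def by simp
  have [measurable]: "Y n \<in> borel_measurable P" for n unfolding Y_def by measurable
  have Y_int: "integrable P (Y n)" for n
  proof (rule P.integrable_bounded)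
    have "\<bar>m n\<bar> \<le> B" unfolding m_def by (rule P.integral_bounded[OF _ emp_B]) simp
    then have "\<bar>emp_mean f n \<omega> - m n\<bar> \<le> 2 * B" for \<omega> using emp_B[of n \<omega>] by linarith
    from power_mono[OF this, where n=4] show "\<bar>Y n \<omega>\<bar> \<le> (2 * B) ^ 4" for \<omega>
      unfolding Y_def by (simp add: power_abs)
  qed simp
  have sumC: "summable (\<lambda>n. C / (real n * sqrt (real n)))"
  proof -
    have "summable (\<lambda>n. C * (1 / real n powr (3/2)))"
      by (intro summable_mult) (simp add: summable_real_powr_iff powr_minus_divide[symmetric])
    moreover have "C * (1 / real n powr (3/2)) = C / (real n * sqrt (real n))" for n
      using powr_add[of "real n" 1 "1/2"] by (cases "n = 0") (simp_all add: powr_half_sqrt)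
    ultimately show ?thesis by (simp only:)
  qed
  have "summable (\<lambda>n. \<integral>\<omega>. Y n \<omega> \<partial>P)"
  proof (rule summable_comparison_test'[OF sumC, of 1])
    fix n :: nat assume "1 \<le> n"
    then show "norm (\<integral>\<omega>. Y n \<omega> \<partial>P) \<le> C / (real n * sqrt (real n))"
      using 4[of n] Y0 by (simp add: Y_def)
  qed
  then have fin: "(\<Sum>n. ennreal (\<integral>\<omega>. Y n \<omega> \<partial>P)) \<noteq> \<infinity>"
    using Y0 by (simp add: suminf_ennreal2 ennreal_suminf_neq_top)
  have "(\<integral>\<^sup>+\<omega>. (\<Sum>n. ennreal (Y n \<omega>)) \<partial>P) = (\<Sum>n. \<integral>\<^sup>+\<omega>. ennreal (Y n \<omega>) \<partial>P)"
    by (intro nn_integral_suminf) measurable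
  also have "\<dots> = (\<Sum>n. ennreal (\<integral>\<omega>. Y n \<omega> \<partial>P))"
    using Y_int Y0 by (simp add: nn_integral_eq_integral)
  finally have "(\<integral>\<^sup>+\<omega>. (\<Sum>n. ennreal (Y n \<omega>)) \<partial>P) \<noteq> \<infinity>" using fin by simp
  then have "AE \<omega> in P. (\<Sum>n. ennreal (Y n \<omega>)) \<noteq> \<infinity>"
    by (intro nn_integral_PInf_AE) measurable
  then show ?thesis
  proof eventually_elim
    case (elim \<omega>)
    then have "summable (\<lambda>n. Y n \<omega>)"
      using Y0 by (intro summable_suminf_not_top) auto
    then have "(\<lambda>n. Y n \<omega>) \<longlonglongrightarrow> 0" by (rule summable_LIMSEQ_zero)
    then have "(\<lambda>n. root 4 (Y n \<omega>)) \<longlonglongrightarrow> root 4 0" by (intro tendsto_real_root)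
    moreover have "root 4 (Y n \<omega>) = \<bar>emp_mean f n \<omega> - m n\<bar>" for n
      using real_root_power_cancel[of 4 "\<bar>emp_mean f n \<omega> - m n\<bar>"] by (simp add: Y_def power_abs)
    ultimately have "(\<lambda>n. \<bar>emp_mean f n \<omega> - m n\<bar>) \<longlonglongrightarrow> 0" by simp
    then show ?case unfolding m_def by (simp add: tendsto_rabs_zero_iff)
  qed
qed

subsection \<open>Convergence of the means\<close>

lemma (in real_distribution) char_approx_third_moment:
  assumes "integrable M (\<lambda>x. x)" "expectation (\<lambda>x. x) = 0" "integrable M (\<lambda>x. x\<^sup>2)"
    "variance (\<lambda>x. x) = 1" "integrable M (\<lambda>x. \<bar>x\<bar> ^ 3)"
  shows "cmod (char M s - (1 - s\<^sup>2 / 2)) \<le> \<bar>s\<bar> ^ 3 / 6 * expectation (\<lambda>x. \<bar>x\<bar> ^ 3)"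
proof -
  have "cmod (char M s - (1 - s\<^sup>2 / 2)) \<le> (s\<^sup>2 / 6) * expectation (\<lambda>x. min (6 * x\<^sup>2) (\<bar>s\<bar> * \<bar>x\<bar> ^ 3))"
    using char_approx3[OF assms(1-4), of s] by simp
  also have "\<dots> \<le> (s\<^sup>2 / 6) * expectation (\<lambda>x. \<bar>s\<bar> * \<bar>x\<bar> ^ 3)"
  proof (intro mult_left_mono integral_mono)
    show "integrable M (\<lambda>x. \<bar>s\<bar> * \<bar>x\<bar> ^ 3)" using assms(5) by simp
    then show "integrable M (\<lambda>x. min (6 * x\<^sup>2) (\<bar>s\<bar> * \<bar>x\<bar> ^ 3))"
      using assms(3) by (intro integrable_min) auto
  qed auto
  also have "\<dots> = (s\<^sup>2 * \<bar>s\<bar>) / 6 * expectation (\<lambda>x. \<bar>x\<bar> ^ 3)"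
    by simp
  also have "s\<^sup>2 * \<bar>s\<bar> = \<bar>s\<bar> ^ 3"
    by (simp add: power3_eq_cube power2_eq_square)
  finally show ?thesis .
qed

lemma indep_vars_PiM_coordinate:
  assumes "\<And>i. prob_space (M i)" "finite J" "J \<noteq> {}" "J \<subseteq> I"
  shows "prob_space.indep_vars (PiM I M) M (\<lambda>i x. x i) J"
proof -
  interpret product_prob_space M I by (intro product_prob_spaceI assms(1))
  have "distr (PiM I M) (PiM J M) (\<lambda>x. \<lambda>i\<in>J. x i) = PiM J M"
    using distr_PiM_restrict_finite[OF assms(2,4)] by (simp add: restrict_def)
  also have "\<dots> = PiM J (\<lambda>i. distr (PiM I M) (M i) (\<lambda>x. x i))"
    using assms(4) by (intro PiM_cong refl) (auto simp: PiM_component)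
  finally show ?thesis
    using assms(3,4) by (subst indep_vars_iff_distr_eq_PiM') auto
qed

lemma std_normal_abs3_integrable: "integrable std_normal_distribution (\<lambda>x. \<bar>x\<bar> ^ 3)"
  using integrable_abs[OF integrable_std_normal_distribution_moment[of 3]] by (simp add: power_abs)

lemma cmod_char_S_minus_normal_le:
  assumes D: "prob_space D" and sets: "sets D = sets borel"
    and moments: "\<And>m. integrable D (\<lambda>x. x ^ m)"
    and mean: "prob_space.expectation D (\<lambda>x. x) = 0" and var: "prob_space.variance D (\<lambda>x. x) = 1"
    and k: "1 \<le> k" "k < n"
  defines "P \<equiv> PiM {1::nat..} (\<lambda>_. D)"
  defines "\<beta> \<equiv> ((\<integral>x. \<bar>x\<bar> ^ 3 \<partial>D) + (\<integral>x. \<bar>x\<bar> ^ 3 \<partial>std_normal_distribution)) / 6"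
  shows "cmod (char (distr P borel (S n k)) t - char std_normal_distribution t) \<le> \<bar>t\<bar> ^ 3 * sqrt (2 / real n) * \<beta>"
proof -
  interpret D: prob_space D by fact
  interpret D: real_distribution D
    using sets sets_eq_imp_space_eq[OF sets] by unfold_locales auto
  interpret N: real_distribution std_normal_distribution by (rule real_dist_normal_dist)
  interpret P: prob_space P unfolding P_def by (intro prob_space_PiM D)
  define c where "c l = cos (pi * real k * real l / real n) / sqrt (real n / 2)" for l :: nat
  have D3: "integrable D (\<lambda>x. \<bar>x\<bar> ^ 3)"
    using integrable_abs[OF moments[of 3]] by (simp add: power_abs)
  have b0: "0 \<le> \<beta>" unfolding \<beta>_def by simp
  have close: "cmod (char D s - char std_normal_distribution s) \<le> \<bar>s\<bar> ^ 3 * \<beta>" for s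
  proof -
    have 1: "cmod (char D s - (1 - s\<^sup>2 / 2)) \<le> \<bar>s\<bar> ^ 3 / 6 * (\<integral>x. \<bar>x\<bar> ^ 3 \<partial>D)"
      using moments[of 1] moments[of 2] mean var D3 by (intro D.char_approx_third_moment) auto
    have 2: "cmod (char std_normal_distribution s - (1 - s\<^sup>2 / 2)) \<le> \<bar>s\<bar> ^ 3 / 6 * (\<integral>x. \<bar>x\<bar> ^ 3 \<partial>std_normal_distribution)"
    proof (rule N.char_approx_third_moment)
      show m0: "N.expectation (\<lambda>x. x) = 0"
        using integral_std_normal_distribution_moment_odd[of 1] by simp
      show "N.variance (\<lambda>x. x) = 1"
        using std_normal_distribution_even_moments[of 1] by (simp add: m0 has_bochner_integral_integral_eq)
    qed (use integrable_std_normal_distribution_moment[of 1] integrable_std_normal_distribution_moment[of 2] std_normal_abs3_integrable in auto)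
    have "cmod (char D s - char std_normal_distribution s) \<le>
        cmod (char D s - (1 - s\<^sup>2 / 2)) + cmod (char std_normal_distribution s - (1 - s\<^sup>2 / 2))"
      using norm_triangle_ineq4[of "char D s - (1 - s\<^sup>2 / 2)" "char std_normal_distribution s - (1 - s\<^sup>2 / 2)"] by simp
    also have "\<dots> \<le> \<bar>s\<bar> ^ 3 / 6 * (\<integral>x. \<bar>x\<bar> ^ 3 \<partial>D) + \<bar>s\<bar> ^ 3 / 6 * (\<integral>x. \<bar>x\<bar> ^ 3 \<partial>std_normal_distribution)"
      by (rule add_mono[OF 1 2])
    also have "\<dots> = \<bar>s\<bar> ^ 3 * \<beta>"
      unfolding \<beta>_def by (simp add: algebra_simps add_divide_distrib)
    finally show ?thesis .
  qed
  have comp_m: "(\<lambda>\<omega>. \<omega> l) \<in> measurable P D" if "l \<in> {1..n}" for l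
    using that unfolding P_def by (intro measurable_component_singleton) auto
  have meas: "(\<lambda>x. x) \<in> borel_measurable D" using sets by simp
  have "P.indep_vars (\<lambda>_. D) (\<lambda>l \<omega>. \<omega> l) {1..n}"
    unfolding P_def by (rule indep_vars_PiM_coordinate) (use D k in auto)
  then have "P.indep_vars (\<lambda>_. borel) (\<lambda>l \<omega>. \<omega> l * c l) {1..n}"
    by (rule P.indep_vars_compose2[where Y="\<lambda>l x. x * c l"]) (use meas in simp)
  then have "char (distr P borel (\<lambda>\<omega>. \<Sum>l\<in>{1..n}. \<omega> l * c l)) t = (\<Prod>l\<in>{1..n}. char (distr P borel (\<lambda>\<omega>. \<omega> l * c l)) t)"
    by (rule P.char_distr_sum)
  also have "(\<lambda>\<omega>. \<Sum>l\<in>{1..n}. \<omega> l * c l) = S n k"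
    by (simp add: fun_eq_iff S_eq c_def)
  also have "(\<Prod>l\<in>{1..n}. char (distr P borel (\<lambda>\<omega>. \<omega> l * c l)) t) = (\<Prod>l\<in>{1..n}. char D (t * c l))"
  proof (rule prod.cong[OF refl])
    fix l assume l: "l \<in> {1..n}"
    have [measurable]: "(\<lambda>\<omega>. \<omega> l) \<in> borel_measurable P"
      using comp_m[OF l] by (simp only: measurable_cong_sets[OF refl sets])
    have "char (distr P borel (\<lambda>\<omega>. \<omega> l * c l)) t = (\<integral>\<omega>. iexp (t * (\<omega> l * c l)) \<partial>P)"
      unfolding char_def by (subst integral_distr) auto
    also have "\<dots> = (\<integral>\<omega>. iexp ((t * c l) * \<omega> l) \<partial>P)"
    proof -
      have "t * (x * c l) = (t * c l) * x" for x by simp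
      then show ?thesis by (simp only:)
    qed
    also have "\<dots> = (\<integral>x. iexp ((t * c l) * x) \<partial>distr P D (\<lambda>\<omega>. \<omega> l))"
    proof (rule integral_distr[OF comp_m[OF l], symmetric])
      show "(\<lambda>x. iexp ((t * c l) * x)) \<in> borel_measurable D"
        unfolding measurable_cong_sets[OF sets refl] by measurable
    qed
    also have "distr P D (\<lambda>\<omega>. \<omega> l) = D"
      unfolding P_def by (rule distr_PiM_component) (use D l in auto)
    finally show "char (distr P borel (\<lambda>\<omega>. \<omega> l * c l)) t = char D (t * c l)"
      by (simp add: char_def)
  qed
  finally have char_S: "char (distr P borel (S n k)) t = (\<Prod>l\<in>{1..n}. char D (t * c l))" .
  have c2: "(\<Sum>l\<in>{1..n}. (c l)\<^sup>2) = 1"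
    unfolding c_def by (rule sum_cos_squared_coeffs[OF k])
  have "(\<Prod>l\<in>{1..n}. exp (- ((t * c l)\<^sup>2) / 2)) = exp (\<Sum>l\<in>{1..n}. - ((t * c l)\<^sup>2) / 2)"
    by (simp add: exp_sum)
  also have "(\<Sum>l\<in>{1..n}. - ((t * c l)\<^sup>2) / 2) = (\<Sum>l\<in>{1..n}. - (t\<^sup>2) / 2 * (c l)\<^sup>2)"
    by (intro sum.cong) (auto simp: power_mult_distrib)
  also have "\<dots> = - (t\<^sup>2) / 2"
    by (simp only: sum_distrib_left[symmetric] c2)
  finally have char_N: "char std_normal_distribution t = (\<Prod>l\<in>{1..n}. char std_normal_distribution (t * c l))"
    by (simp only: char_std_normal_distribution of_real_prod[symmetric])
  have "cmod (char (distr P borel (S n k)) t - char std_normal_distribution t)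
     \<le> (\<Sum>l\<in>{1..n}. cmod (char D (t * c l) - char std_normal_distribution (t * c l)))"
    unfolding char_S by (subst char_N) (intro norm_prod_diff D.cmod_char_le_1 N.cmod_char_le_1)
  also have "\<dots> \<le> (\<Sum>l\<in>{1..n}. \<bar>t * c l\<bar> ^ 3 * \<beta>)"
    by (intro sum_mono close)
  also have "\<dots> \<le> (\<Sum>l\<in>{1..n}. (\<bar>t\<bar> ^ 3 * sqrt (2 / real n) * \<beta>) * (c l)\<^sup>2)"
  proof (rule sum_mono)
    fix l
    have "\<bar>c l\<bar> \<le> sqrt (2 / real n)"
      unfolding c_def by (rule real_le_rsqrt) (simp only: power2_abs cos_coeff_squared_le)
    then have "\<bar>c l\<bar> * (c l)\<^sup>2 \<le> sqrt (2 / real n) * (c l)\<^sup>2" by (rule mult_right_mono) simp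
    then have "(\<bar>t\<bar> ^ 3 * \<beta>) * (\<bar>c l\<bar> * (c l)\<^sup>2) \<le> (\<bar>t\<bar> ^ 3 * \<beta>) * (sqrt (2 / real n) * (c l)\<^sup>2)"
      using b0 by (intro mult_left_mono) auto
    moreover have "\<bar>c l\<bar> * (c l)\<^sup>2 = \<bar>c l\<bar> ^ 3" by (simp add: power3_eq_cube power2_eq_square)
    ultimately show "\<bar>t * c l\<bar> ^ 3 * \<beta> \<le> (\<bar>t\<bar> ^ 3 * sqrt (2 / real n) * \<beta>) * (c l)\<^sup>2"
      by (simp add: abs_mult power_mult_distrib mult_ac)
  qed
  also have "\<dots> = \<bar>t\<bar> ^ 3 * sqrt (2 / real n) * \<beta>"
    by (simp only: sum_distrib_left[symmetric] c2)
  finally show ?thesis .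
qed

lemma expectation_emp_mean_tendsto:
  fixes f :: "real \<Rightarrow> real"
  assumes D: "prob_space D" and sets: "sets D = sets borel"
    and moments: "\<And>m. integrable D (\<lambda>x. x ^ m)"
    and mean: "prob_space.expectation D (\<lambda>x. x) = 0" and var: "prob_space.variance D (\<lambda>x. x) = 1"
    and f: "\<And>x. isCont f x" and B: "\<And>x. \<bar>f x\<bar> \<le> B"
  defines "P \<equiv> PiM {1::nat..} (\<lambda>_. D)"
  shows "(\<lambda>n. \<integral>\<omega>. emp_mean f n \<omega> \<partial>P) \<longlonglongrightarrow> (\<integral>x. f x \<partial>std_normal_distribution)"
proof -
  interpret P: prob_space P unfolding P_def by (intro prob_space_PiM D)
  interpret N: real_distribution std_normal_distribution by (rule real_dist_normal_dist)
  define I where "I = (\<integral>x. f x \<partial>std_normal_distribution)"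
  define a where "a n k = (\<integral>\<omega>. f (S n k \<omega>) \<partial>P)" for n k
  have f_m [measurable]: "f \<in> borel_measurable borel"
    using f by (intro borel_measurable_continuous_onI continuous_at_imp_continuous_on) auto
  have S_m [measurable]: "S n k \<in> borel_measurable P" for n k
    unfolding P_def by (rule S_measurable[OF sets]) auto
  have int: "integrable P (\<lambda>\<omega>. f (S n k \<omega>))" for n k
    using B by (intro P.integrable_bounded) auto
  have a_B: "\<bar>a n k\<bar> \<le> B" for n k
    unfolding a_def using B by (intro P.integral_bounded) auto
  have I_B: "\<bar>I\<bar> \<le> B"
    unfolding I_def using B f_m by (intro N.integral_bounded) auto
  \<comment> \<open>Choosing the worst index \<open>k < n\<close> for each \<open>n\<close> makes weak convergence along \<open>S n (kk n)\<close> uniform in \<open>k\<close>.\<close>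
  have "\<exists>k\<in>{1..n+1}. \<forall>j\<in>{1..n+1}. \<bar>a (n+2) j - I\<bar> \<le> \<bar>a (n+2) k - I\<bar>" for n
  proof -
    let ?g = "\<lambda>k. \<bar>a (n+2) k - I\<bar>"
    have "Max (?g ` {1..n+1}) \<in> ?g ` {1..n+1}" by (rule Max_in) auto
    then obtain k where "Max (?g ` {1..n+1}) = ?g k" "k \<in> {1..n+1}" by (rule imageE)
    moreover have "?g j \<le> Max (?g ` {1..n+1})" if "j \<in> {1..n+1}" for j
      by (rule Max_ge) (use that in auto)
    ultimately have "\<forall>j\<in>{1..n+1}. ?g j \<le> ?g k" by (simp only:) blast
    then show ?thesis using \<open>k \<in> {1..n+1}\<close> by (rule bexI)
  qed
  then obtain kk where kk: "\<And>n. kk n \<in> {1..n+1}"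
    "\<And>n j. j \<in> {1..n+1} \<Longrightarrow> \<bar>a (n+2) j - I\<bar> \<le> \<bar>a (n+2) (kk n) - I\<bar>"
    by metis
  have "weak_conv_m (\<lambda>n. distr P borel (S (n+2) (kk n))) std_normal_distribution"
  proof (rule levy_continuity)
    fix t
    define \<beta> where "\<beta> = ((\<integral>x. \<bar>x\<bar> ^ 3 \<partial>D) + (\<integral>x. \<bar>x\<bar> ^ 3 \<partial>std_normal_distribution)) / 6"
    have bound: "cmod (char (distr P borel (S (n+2) (kk n))) t - char std_normal_distribution t) \<le> \<bar>t\<bar> ^ 3 * sqrt (2 / real (n+2)) * \<beta>" for n
      unfolding P_def \<beta>_def using kk(1)[of n]
      by (intro cmod_char_S_minus_normal_le[OF D sets moments mean var]) auto
    have "(\<lambda>n. \<bar>t\<bar> ^ 3 * sqrt (2 / real (n+2)) * \<beta>) \<longlonglongrightarrow> \<bar>t\<bar> ^ 3 * sqrt 0 * \<beta>"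
      by (intro tendsto_mult tendsto_real_sqrt tendsto_const LIMSEQ_ignore_initial_segment[where f="\<lambda>n. 2 / real n"] lim_const_over_n)
    then have lim0: "(\<lambda>n. \<bar>t\<bar> ^ 3 * sqrt (2 / real (n+2)) * \<beta>) \<longlonglongrightarrow> 0"
      by (simp only: real_sqrt_zero mult_zero_right mult_zero_left)
    have "(\<lambda>n. char (distr P borel (S (n+2) (kk n))) t - char std_normal_distribution t) \<longlonglongrightarrow> 0"
      by (rule Lim_null_comparison[OF _ lim0]) (intro always_eventually allI bound)
    then show "(\<lambda>n. char (distr P borel (S (n+2) (kk n))) t) \<longlonglongrightarrow> char std_normal_distribution t"
      by (simp add: LIM_zero_iff)
  qed (auto intro: real_dist_normal_dist)
  then have "(\<lambda>n. integral\<^sup>L (distr P borel (S (n+2) (kk n))) f) \<longlonglongrightarrow> I"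
    unfolding I_def
    by (intro weak_conv_imp_integral_bdd_continuous_conv[where B=B]) (use f B in \<open>auto intro: real_dist_normal_dist\<close>)
  then have "(\<lambda>n. a (n+2) (kk n)) \<longlonglongrightarrow> I"
    by (simp add: a_def integral_distr)
  then have lim1: "(\<lambda>n. \<bar>a (n+2) (kk n) - I\<bar>) \<longlonglongrightarrow> 0"
    by (simp add: LIM_zero tendsto_rabs_zero)
  have lim2: "(\<lambda>n. 2 * B / real (n+2)) \<longlonglongrightarrow> 0"
    by (rule LIMSEQ_ignore_initial_segment[where f="\<lambda>n. 2 * B / real n"]) (rule lim_const_over_n)
  have emp_a: "(\<integral>\<omega>. emp_mean f n \<omega> \<partial>P) = (\<Sum>k=1..n. a n k) / real n" for n
    unfolding emp_mean_def a_def using int by (simp add: Bochner_Integration.integral_sum)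
  have bound: "\<bar>(\<integral>\<omega>. emp_mean f (n+2) \<omega> \<partial>P) - I\<bar> \<le> \<bar>a (n+2) (kk n) - I\<bar> + 2 * B / real (n+2)" for n
  proof -
    let ?N = "n + 2"
    have "(\<integral>\<omega>. emp_mean f ?N \<omega> \<partial>P) - I = (\<Sum>k=1..?N. a ?N k - I) / real ?N"
      unfolding emp_a by (simp only: sum_subtractf sum_constant card_atLeastAtMost) (simp add: field_simps)
    also have "\<bar>\<dots>\<bar> \<le> (\<Sum>k=1..?N. \<bar>a ?N k - I\<bar>) / real ?N"
      by (simp only: abs_divide abs_of_nat) (intro divide_right_mono sum_abs of_nat_0_le_iff)
    also have "(\<Sum>k=1..?N. \<bar>a ?N k - I\<bar>) = (\<Sum>k=1..n+1. \<bar>a ?N k - I\<bar>) + \<bar>a ?N ?N - I\<bar>"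
      by (simp add: numeral_2_eq_2)
    also have "\<dots> \<le> (\<Sum>k=1..n+1. \<bar>a ?N (kk n) - I\<bar>) + 2 * B"
      using a_B[of ?N ?N] I_B by (intro add_mono sum_mono kk(2)) auto
    also have "\<dots> \<le> real ?N * \<bar>a ?N (kk n) - I\<bar> + 2 * B"
      by (intro add_right_mono) (simp add: mult_right_mono)
    finally show ?thesis by (simp add: divide_right_mono add_divide_distrib)
  qed
  have lim3: "(\<lambda>n. \<bar>a (n+2) (kk n) - I\<bar> + 2 * B / real (n+2)) \<longlonglongrightarrow> 0"
    using tendsto_add[OF lim1 lim2] by simp
  have "(\<lambda>n. (\<integral>\<omega>. emp_mean f (n+2) \<omega> \<partial>P) - I) \<longlonglongrightarrow> 0"
    by (rule Lim_null_comparison[OF _ lim3], unfold real_norm_def) (intro always_eventually allI bound)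
  then have "(\<lambda>n. \<integral>\<omega>. emp_mean f (n+2) \<omega> \<partial>P) \<longlonglongrightarrow> I" by (simp add: LIM_zero_iff)
  then show ?thesis unfolding I_def[symmetric] by (rule LIMSEQ_offset)
qed

subsection \<open>Smoothed step functions\<close>

definition pos_part_sq :: "real \<Rightarrow> real" where "pos_part_sq u = (max 0 u)\<^sup>2"

lemma pos_part_sq_taylor: "\<bar>pos_part_sq v - pos_part_sq u - 2 * max 0 u * (v - u)\<bar> \<le> (v - u)\<^sup>2"
proof -
  consider "0 \<le> u" "0 \<le> v" | "u \<le> 0" "v \<le> 0" | "0 \<le> u" "v \<le> 0" | "u \<le> 0" "0 \<le> v" by linarith
  then show ?thesis
  proof cases
    case 1
    then have "pos_part_sq v - pos_part_sq u - 2 * max 0 u * (v - u) = (v - u)\<^sup>2"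
      by (simp add: pos_part_sq_def power2_eq_square algebra_simps)
    then show ?thesis by simp
  next
    case 3
    then have "pos_part_sq v - pos_part_sq u - 2 * max 0 u * (v - u) = (v - u)\<^sup>2 - v\<^sup>2"
      by (simp add: pos_part_sq_def power2_eq_square algebra_simps)
    moreover have "v * u \<le> 0" using 3 by (simp add: mult_nonpos_nonneg)
    then have "v\<^sup>2 \<le> (v - u)\<^sup>2" using zero_le_power2[of u] unfolding power2_diff by linarith
    ultimately show ?thesis using zero_le_power2[of v] by linarith
  next
    case 4
    then have "pos_part_sq v - pos_part_sq u - 2 * max 0 u * (v - u) = v\<^sup>2"
      by (simp add: pos_part_sq_def)
    moreover have "v\<^sup>2 \<le> (v - u)\<^sup>2" using 4 by (intro power_mono) auto
    ultimately show ?thesis by simp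
  qed (simp add: pos_part_sq_def)
qed

text \<open>The second derivative is \<open>-4\<close> on \<open>[0, 1/2]\<close>, \<open>4\<close> on \<open>[1/2, 1]\<close> and 0 elsewhere.\<close>

definition smooth_step :: "real \<Rightarrow> real" where
  "smooth_step u = 1 - 2 * pos_part_sq u + 4 * pos_part_sq (u - 1/2) - 2 * pos_part_sq (u - 1)"

definition smooth_step' :: "real \<Rightarrow> real" where
  "smooth_step' u = - 4 * max 0 u + 8 * max 0 (u - 1/2) - 4 * max 0 (u - 1)"

lemma smooth_step_taylor:
  "\<bar>smooth_step v - smooth_step u - smooth_step' u * (v - u)\<bar> \<le> 8 * (v - u)\<^sup>2"
proof -
  define e where "e a = pos_part_sq (v - a) - pos_part_sq (u - a) - 2 * max 0 (u - a) * (v - u)" for a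
  have e: "\<bar>e a\<bar> \<le> (v - u)\<^sup>2" for a
    using pos_part_sq_taylor[of "v - a" "u - a"] by (simp add: e_def)
  have "smooth_step v - smooth_step u - smooth_step' u * (v - u) = - 2 * e 0 + 4 * e (1/2) - 2 * e 1"
    unfolding smooth_step_def smooth_step'_def e_def by (simp add: algebra_simps)
  then show ?thesis using e[of 0] e[of "1/2"] e[of 1] by linarith
qed

lemma smooth_step'_bounded: "\<bar>smooth_step' u\<bar> \<le> 2"
  unfolding smooth_step'_def by (auto simp: max_def)

lemma smooth_step_le_0: "u \<le> 0 \<Longrightarrow> smooth_step u = 1"
  unfolding smooth_step_def pos_part_sq_def by simp

lemma smooth_step_ge_1: "1 \<le> u \<Longrightarrow> smooth_step u = 0"
  unfolding smooth_step_def pos_part_sq_def by (simp add: power2_eq_square algebra_simps)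

lemma smooth_step_range: "0 \<le> smooth_step u" "smooth_step u \<le> 1"
proof -
  consider "u \<le> 0" | "0 \<le> u" "u \<le> 1/2" | "1/2 \<le> u" "u \<le> 1" | "1 \<le> u" by linarith
  then have "0 \<le> smooth_step u \<and> smooth_step u \<le> 1"
  proof cases
    case 2
    then have "smooth_step u = 1 - 2 * u\<^sup>2" by (simp add: smooth_step_def pos_part_sq_def)
    moreover have "u\<^sup>2 \<le> (1/2)\<^sup>2" using 2 by (intro power_mono) auto
    ultimately show ?thesis by (simp add: power2_eq_square)
  next
    case 3
    then have "smooth_step u = 2 * (1 - u)\<^sup>2"
      by (simp add: smooth_step_def pos_part_sq_def power2_eq_square algebra_simps)
    moreover have "(1 - u)\<^sup>2 \<le> (1/2)\<^sup>2" using 3 by (intro power_mono) auto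
    ultimately show ?thesis by (simp add: power2_eq_square)
  qed (auto simp: smooth_step_le_0 smooth_step_ge_1)
  then show "0 \<le> smooth_step u" "smooth_step u \<le> 1" by auto
qed

lemma isCont_smooth_step: "isCont smooth_step u"
  unfolding smooth_step_def pos_part_sq_def by (intro continuous_intros)

subsection \<open>The normal distribution function and Polya's theorem\<close>

lemma Phi_eq_cdf: "Phi x = cdf std_normal_distribution x"
proof -
  interpret N: real_distribution std_normal_distribution by (rule real_dist_normal_dist)
  have "cdf std_normal_distribution x = (\<integral>t. indicator {..x} t \<partial>std_normal_distribution)"
    by (simp add: cdf_def)
  also have "\<dots> = (\<integral>t. std_normal_density t *\<^sub>R indicator {..x} t \<partial>lborel)"
    by (subst integral_density) auto
  also have "\<dots> = (LBINT t:{..x}. (1 / sqrt (2 * pi)) * exp (- (t\<^sup>2) / 2))"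
    unfolding set_lebesgue_integral_def
    by (intro Bochner_Integration.integral_cong) (auto simp: std_normal_density_def)
  also have "\<dots> = Phi x"
    unfolding Phi_def by (rule set_integral_mult_right)
  finally show ?thesis by simp
qed

lemma isCont_Phi: "isCont Phi x"
proof -
  interpret N: real_distribution std_normal_distribution by (rule real_dist_normal_dist)
  have "emeasure std_normal_distribution {x} = 0"
  proof -
    have "{x} \<in> null_sets lborel" by (simp add: null_sets_def)
    then have "{x} \<in> null_sets std_normal_distribution"
      using absolutely_continuousI_density[of "\<lambda>x. ennreal (std_normal_density x)" lborel]
      by (auto simp: absolutely_continuous_def)
    then show ?thesis by auto
  qed
  then have "isCont (cdf std_normal_distribution) x"
    by (simp add: N.isCont_cdf measure_def)
  moreover have "Phi = cdf std_normal_distribution" by (simp add: fun_eq_iff Phi_eq_cdf)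
  ultimately show ?thesis by simp
qed

lemma Polya_uniform_convergence:
  fixes F :: "nat \<Rightarrow> real \<Rightarrow> real" and G :: "real \<Rightarrow> real"
  assumes F: "\<And>n. mono (F n)" "\<And>n x. 0 \<le> F n x" "\<And>n x. F n x \<le> 1"
    and G: "mono G" "\<And>x. isCont G x" "(G \<longlongrightarrow> 0) at_bot" "(G \<longlongrightarrow> 1) at_top"
    and conv: "\<And>q. q \<in> \<rat> \<Longrightarrow> (\<lambda>n. F n q) \<longlonglongrightarrow> G q"
  shows "(\<lambda>n. SUP x. \<bar>F n x - G x\<bar>) \<longlonglongrightarrow> 0"
proof (rule LIMSEQ_I)
  have G01: "0 \<le> G x" "G x \<le> 1" for x
  proof -
    have "eventually (\<lambda>y. G y \<le> G x) at_bot"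
      using eventually_le_at_bot[of x] by eventually_elim (use G(1) in \<open>auto dest: monoD\<close>)
    then show "0 \<le> G x" using tendsto_upperbound[OF G(3)] by auto
    have "eventually (\<lambda>y. G x \<le> G y) at_top"
      using eventually_ge_at_top[of x] by eventually_elim (use G(1) in \<open>auto dest: monoD\<close>)
    then show "G x \<le> 1" using tendsto_lowerbound[OF G(4)] by auto
  qed
  fix e :: real assume e: "0 < e"
  define \<epsilon> where "\<epsilon> = e / 3"
  have eps: "0 < \<epsilon>" "\<epsilon> + \<epsilon> < e" using e by (auto simp: \<epsilon>_def)
  have near: "\<exists>q r. q \<in> \<rat> \<and> r \<in> \<rat> \<and> q < x \<and> x < r \<and> G r - G q < \<epsilon>" for x
  proof -
    obtain d where d: "d > 0" "\<And>y. \<bar>y - x\<bar> < d \<Longrightarrow> \<bar>G y - G x\<bar> < \<epsilon> / 2"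
      using G(2)[of x] eps(1) unfolding continuous_at_eps_delta dist_real_def
      by (metis half_gt_zero)
    obtain q where q: "q \<in> \<rat>" "x - d < q" "q < x" using Rats_dense_in_real[of "x - d" x] d by auto
    obtain r where r: "r \<in> \<rat>" "x < r" "r < x + d" using Rats_dense_in_real[of x "x + d"] d by auto
    have "\<bar>G q - G x\<bar> < \<epsilon> / 2" "\<bar>G r - G x\<bar> < \<epsilon> / 2" by (rule d(2), use q r in simp)+
    then have "G r - G q < \<epsilon>" by linarith
    then show ?thesis using q r by auto
  qed
  obtain a where a: "a \<in> \<rat>" "G a < \<epsilon>"
  proof -
    have "eventually (\<lambda>x. G x < \<epsilon>) at_bot" using G(3) eps(1) by (rule order_tendstoD)
    then obtain b where "\<And>x. x \<le> b \<Longrightarrow> G x < \<epsilon>" by (auto simp: eventually_at_bot_linorder)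
    moreover obtain q where "q \<in> \<rat>" "q < b" using Rats_dense_in_real[of "b - 1" b] by auto
    ultimately show ?thesis using that by auto
  qed
  obtain b where b: "b \<in> \<rat>" "1 - \<epsilon> < G b"
  proof -
    have "eventually (\<lambda>x. 1 - \<epsilon> < G x) at_top" using G(4) eps(1) by (intro order_tendstoD) auto
    then obtain c where "\<And>x. x \<ge> c \<Longrightarrow> 1 - \<epsilon> < G x" by (auto simp: eventually_at_top_linorder)
    moreover obtain q where "q \<in> \<rat>" "c < q" using Rats_dense_in_real[of c "c + 1"] by auto
    ultimately show ?thesis using that by auto
  qed
  from near obtain ql qr where qr: "\<And>x. ql x \<in> \<rat>" "\<And>x. qr x \<in> \<rat>" "\<And>x. ql x < x" "\<And>x. x < qr x"
    "\<And>x. G (qr x) - G (ql x) < \<epsilon>" by metis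
  obtain T where T: "finite T" "{a..b} \<subseteq> (\<Union>x\<in>T. {ql x<..<qr x})"
    by (rule compactE_image[of "{a..b}" "{a..b}" "\<lambda>x. {ql x<..<qr x}"]) (use qr in auto)
  define Q where "Q = insert a (insert b (ql ` T \<union> qr ` T))"
  have Q: "finite Q" "Q \<subseteq> \<rat>" using T a b qr by (auto simp: Q_def)
  have "eventually (\<lambda>n. \<forall>q\<in>Q. \<bar>F n q - G q\<bar> < \<epsilon>) sequentially"
  proof (rule eventually_ball_finite[OF Q(1)], rule ballI)
    fix q assume "q \<in> Q"
    then have "(\<lambda>n. F n q) \<longlonglongrightarrow> G q" using Q conv by auto
    then show "eventually (\<lambda>n. \<bar>F n q - G q\<bar> < \<epsilon>) sequentially"
      using eps(1) by (auto simp: tendsto_iff dist_real_def)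
  qed
  then obtain N where N: "\<And>n q. n \<ge> N \<Longrightarrow> q \<in> Q \<Longrightarrow> \<bar>F n q - G q\<bar> < \<epsilon>"
    by (auto simp: eventually_sequentially)
  have main: "\<bar>F n x - G x\<bar> \<le> \<epsilon> + \<epsilon>" if n: "n \<ge> N" for n x
  proof -
    consider "x < a" | "b < x" | "x \<in> {a..b}" by fastforce
    then show ?thesis
    proof cases
      case 1
      then have "F n x \<le> F n a" "G x \<le> G a"
        using monoD[OF F(1)] monoD[OF G(1)] by simp_all
      moreover have "\<bar>F n a - G a\<bar> < \<epsilon>" using N n by (auto simp: Q_def)
      ultimately show ?thesis using F(2)[of n x] G01[of x] a(2) by linarith
    next
      case 2
      then have "F n b \<le> F n x" "G b \<le> G x"
        using monoD[OF F(1)] monoD[OF G(1)] by simp_all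
      moreover have "\<bar>F n b - G b\<bar> < \<epsilon>" using N n by (auto simp: Q_def)
      ultimately show ?thesis using F(3)[of n x] G01[of x] b(2) by linarith
    next
      case 3
      then obtain y where y: "y \<in> T" "ql y < x" "x < qr y" using T by auto
      then have "F n (ql y) \<le> F n x" "F n x \<le> F n (qr y)" "G (ql y) \<le> G x" "G x \<le> G (qr y)"
        using monoD[OF F(1)] monoD[OF G(1)] by simp_all
      moreover have "\<bar>F n (ql y) - G (ql y)\<bar> < \<epsilon>" "\<bar>F n (qr y) - G (qr y)\<bar> < \<epsilon>"
        using N n y by (auto simp: Q_def)
      ultimately show ?thesis using qr(5)[of y] by linarith
    qed
  qed
  have bdd: "bdd_above (range (\<lambda>x. \<bar>F n x - G x\<bar>))" for n
  proof (rule bdd_aboveI2)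
    show "\<bar>F n x - G x\<bar> \<le> 1" for x using F(2,3)[of n x] G01[of x] by linarith
  qed
  show "\<exists>no. \<forall>n\<ge>no. norm ((SUP x. \<bar>F n x - G x\<bar>) - 0) < e"
  proof (intro exI allI impI)
    fix n assume n: "N \<le> n"
    have "(SUP x. \<bar>F n x - G x\<bar>) \<le> \<epsilon> + \<epsilon>" by (rule cSUP_least) (use main[OF n] in auto)
    moreover have "\<bar>F n 0 - G 0\<bar> \<le> (SUP x. \<bar>F n x - G x\<bar>)" by (rule cSUP_upper[OF _ bdd]) simp
    ultimately show "norm ((SUP x. \<bar>F n x - G x\<bar>) - 0) < e" using eps(2) by simp
  qed
qed

subsection \<open>Almost sure convergence of the distribution functions\<close>

lemma mono_Phi: "mono Phi"
  and Phi_at_bot: "(Phi \<longlongrightarrow> 0) at_bot"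
  and Phi_at_top: "(Phi \<longlongrightarrow> 1) at_top"
proof -
  interpret N: real_distribution std_normal_distribution by (rule real_dist_normal_dist)
  have eq: "Phi = cdf std_normal_distribution" by (simp add: fun_eq_iff Phi_eq_cdf)
  show "mono Phi" unfolding eq by (rule monoI) (rule N.cdf_nondecreasing)
  show "(Phi \<longlongrightarrow> 0) at_bot" unfolding eq by (rule N.cdf_lim_at_bot)
  show "(Phi \<longlongrightarrow> 1) at_top" unfolding eq by (rule N.cdf_lim_at_top_prob)
qed

definition ramp :: "real \<Rightarrow> real \<Rightarrow> real \<Rightarrow> real" where
  "ramp q m x = smooth_step (m * (x - q))"

lemma ramp_bounds:
  assumes "0 < m"
  shows "of_bool (x \<le> q) \<le> ramp q m x" "ramp q m x \<le> of_bool (x \<le> q + 1 / m)"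
proof -
  have "m * (x - q) \<le> 0" if "x \<le> q" using that assms by (simp add: mult_nonneg_nonpos)
  moreover have "1 \<le> m * (x - q)" if "\<not> x \<le> q + 1 / m" using that assms by (simp add: field_simps)
  ultimately show "of_bool (x \<le> q) \<le> ramp q m x" "ramp q m x \<le> of_bool (x \<le> q + 1 / m)"
    using smooth_step_range[of "m * (x - q)"]
    by (auto simp: ramp_def smooth_step_le_0 smooth_step_ge_1)
qed

lemma isCont_ramp: "isCont (ramp q m) x"
  unfolding ramp_def by (rule isCont_o2[OF _ isCont_smooth_step]) (intro continuous_intros)

lemma integral_ramp_le:
  assumes "0 < m"
  shows "Phi q \<le> (\<integral>x. ramp q m x \<partial>std_normal_distribution)"
    and "(\<integral>x. ramp q m x \<partial>std_normal_distribution) \<le> Phi (q + 1 / m)"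
proof -
  interpret N: real_distribution std_normal_distribution by (rule real_dist_normal_dist)
  have Phi: "Phi x = (\<integral>y. of_bool (y \<le> x) \<partial>std_normal_distribution)" for x
  proof -
    have "(\<lambda>y. of_bool (y \<le> x)) = (indicator {..x} :: real \<Rightarrow> real)"
      by (auto simp: fun_eq_iff indicator_def)
    then show ?thesis by (simp add: Phi_eq_cdf cdf_def)
  qed
  have int: "integrable std_normal_distribution (\<lambda>y. of_bool (y \<le> x) :: real)" for x
  proof (rule N.integrable_bounded)
    have "(\<lambda>y. of_bool (y \<le> x)) = (indicator {..x} :: real \<Rightarrow> real)"
      by (auto simp: fun_eq_iff indicator_def)
    then show "(\<lambda>y. of_bool (y \<le> x) :: real) \<in> borel_measurable std_normal_distribution" by simp
    show "\<bar>of_bool (y \<le> x) :: real\<bar> \<le> 1" for y by simp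
  qed
  have "ramp q m \<in> borel_measurable borel"
    by (intro borel_measurable_continuous_onI continuous_at_imp_continuous_on ballI isCont_ramp)
  then have r: "integrable std_normal_distribution (ramp q m)"
    using smooth_step_range by (intro N.integrable_bounded[where B=1]) (auto simp: ramp_def)
  show "Phi q \<le> (\<integral>x. ramp q m x \<partial>std_normal_distribution)"
    unfolding Phi by (intro integral_mono int r ramp_bounds assms)
  show "(\<integral>x. ramp q m x \<partial>std_normal_distribution) \<le> Phi (q + 1 / m)"
    unfolding Phi by (intro integral_mono int r ramp_bounds assms)
qed

lemma emp_mean_mono: "(\<And>x. f x \<le> g x) \<Longrightarrow> emp_mean f n \<omega> \<le> emp_mean g n \<omega>"
  unfolding emp_mean_def by (intro mult_left_mono sum_mono) auto

lemma emp_mean_ramp_tendsto: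
  assumes D: "prob_space D" and sets: "sets D = sets borel"
    and moments: "\<And>m. integrable D (\<lambda>x. x ^ m)"
    and mean: "prob_space.expectation D (\<lambda>x. x) = 0" and var: "prob_space.variance D (\<lambda>x. x) = 1"
  shows "AE \<omega> in PiM {1::nat..} (\<lambda>_. D).
    (\<lambda>n. emp_mean (ramp q m) n \<omega>) \<longlonglongrightarrow> (\<integral>x. ramp q m x \<partial>std_normal_distribution)"
proof -
  let ?P = "PiM {1::nat..} (\<lambda>_. D)"
  have B: "\<bar>ramp q m x\<bar> \<le> 1" for x
    using smooth_step_range by (simp add: ramp_def)
  have L: "\<bar>m * smooth_step' (m * (x - q))\<bar> \<le> \<bar>m\<bar> * 2" for x
    unfolding abs_mult by (intro mult_left_mono smooth_step'_bounded) auto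
  have K: "\<bar>ramp q m y - ramp q m x - m * smooth_step' (m * (x - q)) * (y - x)\<bar> \<le> 8 * m\<^sup>2 * (y - x)\<^sup>2" for x y
  proof -
    have eq: "m * (y - q) - m * (x - q) = m * (y - x)" by (simp add: right_diff_distrib)
    show ?thesis
      using smooth_step_taylor[of "m * (y - q)" "m * (x - q)"]
      unfolding eq ramp_def power_mult_distrib by (simp only: mult_ac)
  qed
  have "ramp q m \<in> borel_measurable borel"
    by (intro borel_measurable_continuous_onI continuous_at_imp_continuous_on ballI isCont_ramp)
  from emp_mean_concentration[OF D sets moments this B L K]
  show ?thesis
  proof eventually_elim
    case (elim \<omega>)
    from tendsto_add[OF elim expectation_emp_mean_tendsto[OF D sets moments mean var isCont_ramp B]]
    show ?case by simp
  qed
qed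

theorem theorem1p6:
  fixes p :: "real \<Rightarrow> real"
  assumes "p \<in> borel_measurable borel"
    and "\<And>t. 0 \<le> p t"
    and "prob_space (law p)"
    and "\<And>m::nat. integrable (law p) (\<lambda>t. t ^ m)"
    and "prob_space.expectation (law p) (\<lambda>t. t) = 0"
    and "prob_space.variance (law p) (\<lambda>t. t) = 1"
  shows "measure (seq_space p)
           {\<omega> \<in> space (seq_space p).
              (\<lambda>n. SUP x. \<bar>1 / real n * (\<Sum>k=1..n. of_bool (S n k \<omega> \<le> x)) - Phi x\<bar>)
                \<longlonglongrightarrow> 0} = 1"
proof -
  let ?P = "seq_space p"
  interpret P: prob_space ?P
    unfolding seq_space_def by (intro prob_space_PiM assms(3))
  have sets: "sets (law p) = sets borel" by (simp add: law_def)
  define F where "F n \<omega> x = 1 / real n * (\<Sum>k=1..n. of_bool (S n k \<omega> \<le> x))" for n \<omega> and x :: real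
  have F_eq: "F n \<omega> x = emp_mean (\<lambda>s. of_bool (s \<le> x)) n \<omega>" for n \<omega> x
    by (simp add: F_def emp_mean_def)
  have F_mono: "mono (F n \<omega>)" for n \<omega>
    unfolding F_eq by (intro monoI emp_mean_mono) auto
  have F0: "0 \<le> F n \<omega> x" for n \<omega> x
    unfolding F_def by (intro mult_nonneg_nonneg sum_nonneg) auto
  have F1: "F n \<omega> x \<le> 1" for n \<omega> x
  proof -
    have "F n \<omega> x \<le> emp_mean (\<lambda>_. 1) n \<omega>" unfolding F_eq by (intro emp_mean_mono) auto
    also have "\<dots> \<le> 1" by (simp add: emp_mean_def)
    finally show ?thesis .
  qed
  have F_m [measurable]: "(\<lambda>\<omega>. F n \<omega> x) \<in> borel_measurable ?P" for n x
  proof -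
    have [measurable]: "S n k \<in> borel_measurable ?P" for k
      unfolding seq_space_def by (rule S_measurable[OF sets]) auto
    have "F n \<omega> x = 1 / real n * (\<Sum>k=1..n. indicator {..x} (S n k \<omega>))" for \<omega>
      by (auto simp: F_def indicator_def intro!: sum.cong)
    then show ?thesis by simp
  qed
  \<comment> \<open>The event of the theorem equals \<open>A\<close>, given by countably many conditions and hence measurable.\<close>
  define A where "A = {\<omega> \<in> space ?P. \<forall>q\<in>\<rat>. (\<lambda>n. F n \<omega> q) \<longlonglongrightarrow> Phi q}"
  have Phi01: "0 \<le> Phi x" "Phi x \<le> 1" for x
    using real_distribution.cdf_bounded_prob[OF real_dist_normal_dist]
    by (auto simp: Phi_eq_cdf cdf_def)
  have iff: "(\<lambda>n. SUP x. \<bar>F n \<omega> x - Phi x\<bar>) \<longlonglongrightarrow> 0 \<longleftrightarrow> (\<forall>q\<in>\<rat>. (\<lambda>n. F n \<omega> q) \<longlonglongrightarrow> Phi q)" for \<omega>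
  proof
    assume lim: "(\<lambda>n. SUP x. \<bar>F n \<omega> x - Phi x\<bar>) \<longlonglongrightarrow> 0"
    show "\<forall>q\<in>\<rat>. (\<lambda>n. F n \<omega> q) \<longlonglongrightarrow> Phi q"
    proof
      fix q :: real
      have "\<bar>F n \<omega> q - Phi q\<bar> \<le> (SUP x. \<bar>F n \<omega> x - Phi x\<bar>)" for n
      proof (rule cSUP_upper)
        show "bdd_above (range (\<lambda>x. \<bar>F n \<omega> x - Phi x\<bar>))"
        proof (rule bdd_aboveI2)
          show "\<bar>F n \<omega> x - Phi x\<bar> \<le> 1" for x using F0[of n \<omega> x] F1[of n \<omega> x] Phi01[of x] by linarith
        qed
      qed simp
      then have "(\<lambda>n. F n \<omega> q - Phi q) \<longlonglongrightarrow> 0"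
        by (intro Lim_null_comparison[OF _ lim] always_eventually allI) (simp only: real_norm_def)
      then show "(\<lambda>n. F n \<omega> q) \<longlonglongrightarrow> Phi q" by (rule LIM_zero_cancel)
    qed
  next
    assume "\<forall>q\<in>\<rat>. (\<lambda>n. F n \<omega> q) \<longlonglongrightarrow> Phi q"
    then show "(\<lambda>n. SUP x. \<bar>F n \<omega> x - Phi x\<bar>) \<longlonglongrightarrow> 0"
      by (intro Polya_uniform_convergence F_mono F0 F1 mono_Phi isCont_Phi Phi_at_bot Phi_at_top) auto
  qed
  have A_m: "A \<in> sets ?P"
  proof -
    have "A = (\<Inter>q\<in>\<rat>. {\<omega> \<in> space ?P. (\<lambda>n. F n \<omega> q) \<longlonglongrightarrow> Phi q})"
      using Rats_0 by (auto simp: A_def)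
    also have "\<dots> \<in> sets ?P"
      using Rats_0 by (intro sets.countable_INT' countable_rat) (auto simp del: Rats_0)
    finally show ?thesis .
  qed
  have "AE \<omega> in ?P. \<forall>q\<in>\<rat>. \<forall>m::nat. (\<lambda>n. emp_mean (ramp q (real (Suc m))) n \<omega>) \<longlonglongrightarrow> (\<integral>x. ramp q (real (Suc m)) x \<partial>std_normal_distribution)"
    unfolding seq_space_def AE_all_countable AE_ball_countable[OF countable_rat]
    by (intro ballI allI emp_mean_ramp_tendsto assms sets)
  then have "AE \<omega> in ?P. \<omega> \<in> A"
    using AE_space
  proof eventually_elim
    case (elim \<omega>)
    note ramp_lim = elim(1)[rule_format]
    have "(\<lambda>n. F n \<omega> q) \<longlonglongrightarrow> Phi q" if q: "q \<in> \<rat>" for q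
    proof (rule LIMSEQ_I)
      fix e :: real assume e: "0 < e"
      obtain d where d: "d > 0" "\<And>y. \<bar>y - q\<bar> < d \<Longrightarrow> \<bar>Phi y - Phi q\<bar> < e / 2"
        using isCont_Phi[of q] e unfolding continuous_at_eps_delta dist_real_def by (metis half_gt_zero)
      obtain m where m: "1 / real (Suc m) < d"
        using reals_Archimedean[OF d(1)] by (auto simp: inverse_eq_divide)
      let ?m = "real (Suc m)"
      have Phi_near: "\<bar>Phi (q + 1 / ?m) - Phi q\<bar> < e / 2" "\<bar>Phi (q - 1 / ?m) - Phi q\<bar> < e / 2"
        by (rule d(2), use m in simp)+
      have "(\<integral>x. ramp q ?m x \<partial>std_normal_distribution) \<le> Phi (q + 1 / ?m)"
        by (rule integral_ramp_le) simp
      then have "(\<integral>x. ramp q ?m x \<partial>std_normal_distribution) < Phi q + e"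
        using Phi_near(1) e by linarith
      then have up: "eventually (\<lambda>n. emp_mean (ramp q ?m) n \<omega> < Phi q + e) sequentially"
        by (rule order_tendstoD(2)[OF ramp_lim[OF q]])
      have q': "q - 1 / ?m \<in> \<rat>" using q by (intro Rats_diff Rats_divide) auto
      have "Phi (q - 1 / ?m) \<le> (\<integral>x. ramp (q - 1 / ?m) ?m x \<partial>std_normal_distribution)"
        by (rule integral_ramp_le) simp
      then have "Phi q - e < (\<integral>x. ramp (q - 1 / ?m) ?m x \<partial>std_normal_distribution)"
        using Phi_near(2) e by linarith
      then have lo: "eventually (\<lambda>n. Phi q - e < emp_mean (ramp (q - 1 / ?m) ?m) n \<omega>) sequentially"
        by (rule order_tendstoD(1)[OF ramp_lim[OF q']])
      have "eventually (\<lambda>n. norm (F n \<omega> q - Phi q) < e) sequentially"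
        using up lo
      proof eventually_elim
        case (elim n)
        have "F n \<omega> q \<le> emp_mean (ramp q ?m) n \<omega>"
          unfolding F_eq by (intro emp_mean_mono ramp_bounds) simp
        moreover have "emp_mean (ramp (q - 1 / ?m) ?m) n \<omega> \<le> F n \<omega> q"
          unfolding F_eq using ramp_bounds(2)[of ?m "q - 1 / ?m"] by (intro emp_mean_mono) simp
        ultimately show ?case using elim by (simp add: abs_less_iff)
      qed
      then show "\<exists>N. \<forall>n\<ge>N. norm (F n \<omega> q - Phi q) < e" by (simp add: eventually_sequentially)
    qed
    then show ?case using elim(2) by (simp add: A_def)
  qed
  then have "measure ?P A = 1" by (simp add: P.prob_eq_1[OF A_m])
  then show ?thesis unfolding A_def iff[symmetric] unfolding F_def .
qed

end
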